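(* Let $G=G(n)$ be a sequence of finite $d$-regular graphs, where $G(n)$ has $n$ vertices and the degree $d=d(n)$ is even with $d\to\infty$ as $n\to\infty$. Suppose that there exist $\ell_{\max}=\ell_{\max}(n)$ with $\ell_{\max}/\log d\to\infty$ and a fixed constant $C>0$ such that \[ c_\ell(G)\le C e^{-(\ell+1)}d^{\ell-1}n\qquad\text{for all integers }3\le \ell\le \ell_{\max}. \] Then $\rho(G)=\widehat\rho(G)+o(1)$ as $n\to\infty$.
   Context: Graphs are finite and simple. An Eulerian orientation of $G$ is an orientation of all edges such that every vertex has in-degree equal to out-degree; $\operatorname{EO}(G)$ denotes their number. For a $d$-regular graph $G$ on $n$ vertices with $d$ even, the residual entropy is $\rho(G)=\frac1n\log\operatorname{EO}(G)$ and Pauling's estimate is $\widehat\rho(G)=\log\binom{d}{d/2}-\frac d2\log 2$. A closed trail is a closed walk using no edge more than once; two closed trails differing only in starting point or direction of traversal are considered the same. $c_\ell(G)$ is the number of closed trails of length $\ell$ in $G$. Asymptotic notation is as $n\to\infty$. *)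

theory Defs
  imports Complex_Main "HOL-Library.Landau_Symbols"
begin

record 'a ugraph =
  verts :: "'a set"
  edges :: "'a set set"

definition simple_graph :: "'a ugraph \<Rightarrow> bool" where
  "simple_graph G \<longleftrightarrow>
     finite (verts G) \<and> (\<forall>e\<in>edges G. e \<subseteq> verts G \<and> card e = 2)"

definition regular_graph :: "nat \<Rightarrow> 'a ugraph \<Rightarrow> bool" where
  "regular_graph d G \<longleftrightarrow> (\<forall>v\<in>verts G. card {e \<in> edges G. v \<in> e} = d)"

definition orientation :: "'a ugraph \<Rightarrow> ('a \<times> 'a) set \<Rightarrow> bool" where
  "orientation G A \<longleftrightarrow>
     (\<forall>u v. (u, v) \<in> A \<longrightarrow> {u, v} \<in> edges G) \<and>
     (\<forall>u v. {u, v} \<in> edges G \<longrightarrow> ((u, v) \<in> A \<longleftrightarrow> (v, u) \<notin> A))"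

definition eulerian_orientation :: "'a ugraph \<Rightarrow> ('a \<times> 'a) set \<Rightarrow> bool" where
  "eulerian_orientation G A \<longleftrightarrow>
     orientation G A \<and>
     (\<forall>v\<in>verts G. card {u. (u, v) \<in> A} = card {u. (v, u) \<in> A})"

definition EO :: "'a ugraph \<Rightarrow> nat" where
  "EO G = card {A. eulerian_orientation G A}"

definition residual_entropy :: "'a ugraph \<Rightarrow> real" where
  "residual_entropy G = ln (real (EO G)) / real (card (verts G))"

text \<open>Pauling's estimate depends on a \<open>d\<close>-regular graph only through \<open>d\<close>.\<close>

definition pauling_estimate :: "nat \<Rightarrow> real" where
  "pauling_estimate d = ln (real (d choose (d div 2))) - real d / 2 * ln 2"

text \<open>
  In a simple graph a walk is determined by its vertices. The closed walk
  \<open>v\<^sub>0 v\<^sub>1 \<dots> v\<^sub>k v\<^sub>0\<close>, of length \<open>k + 1\<close>, is represented by the list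
  \<open>[v\<^sub>0, v\<^sub>1, \<dots>, v\<^sub>k]\<close>, so that the length of the walk is the length of the list.
  Trivial walks of length \<open>0\<close> are left out.
\<close>

definition walk_edges :: "'a list \<Rightarrow> 'a set list" where
  "walk_edges vs = map2 (\<lambda>u v. {u, v}) vs (rotate1 vs)"

definition closed_trail :: "'a ugraph \<Rightarrow> 'a list \<Rightarrow> bool" where
  "closed_trail G vs \<longleftrightarrow>
     vs \<noteq> [] \<and> set (walk_edges vs) \<subseteq> edges G \<and> distinct (walk_edges vs)"

text \<open>Equality of closed walks up to starting point and direction of traversal.\<close>

definition same_trail :: "('a list \<times> 'a list) set" where
  "same_trail = {(vs, ws). \<exists>k. ws = rotate k vs \<or> ws = rotate k (rev vs)}"

definition closed_trail_count :: "nat \<Rightarrow> 'a ugraph \<Rightarrow> nat" where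
  "closed_trail_count l G =
     card ({vs. closed_trail G vs \<and> length vs = l} // same_trail)"

end

theory Submission
  imports Defs "HOL-Library.FuncSet" "HOL-Combinatorics.Permutations"
    "HOL-Analysis.Complex_Transcendental"
begin

text \<open>
  Let \<open>d = 2h\<close>. Pair every Eulerian orientation with a choice, at each vertex \<open>v\<close>, of a perfect matching
  of the darts at \<open>v\<close> that joins outgoing to incoming darts: this multiplies \<open>EO\<close> by \<open>(h!)\<^sup>n\<close>. Choose the
  matchings vertex by vertex. Given those at a set \<open>S\<close>, the compatible orientations are constant along
  the paths through \<open>S\<close> and free otherwise, so such an orientation is balanced at a further vertex \<open>v\<close>
  with probability \<open>\<beta> s = C(s, s/2) / 2\<^sup>s\<close>, where \<open>d - s\<close> is the number of darts at \<open>v\<close> whose path through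
  \<open>S\<close> returns to \<open>v\<close>. Hence the sum of \<open>\<Prod>\<^sub>v 1 / (h! \<beta> s\<^sub>v)\<close> over all pairs is \<open>2\<^bsup>nd/2\<^esup>\<close>. Since
  \<open>\<beta> s \<ge> \<beta> d\<close>, this gives Pauling's lower bound. By Jensen's inequality and convexity of
  \<open>ln \<circ> \<beta>\<close>, the excess of \<open>ln EO\<close> over Pauling's estimate is at most \<open>ln d / d\<close> times the expected
  number of returning darts, for every order of the vertices.

  Take a random order. A dart whose walk visits distinct vertices for \<open>L\<close> steps returns only if its vertex
  comes last among \<open>L + 1\<close> vertices. Any other walk contains a cycle of length \<open>l \<le> L\<close>, and a given cycle is
  traversed with probability at most \<open>h\<^bsup>1-l\<^esup>\<close>, so the bound on the number of closed trails makes such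
  darts rare. The total is \<open>O(ln d (1/L + L\<^sup>3/d))\<close> per vertex, with \<open>L = min(l\<^sub>m\<^sub>a\<^sub>x, d\<^bsup>1/6\<^esup>)\<close>.
\<close>

section \<open>Perfect matchings\<close>

text \<open>A perfect matching is encoded as a fixed-point-free involution. Being the identity
  outside \<open>X\<close> makes the function unique, so that counting functions counts
  matchings.\<close>

definition matchings :: "'a set \<Rightarrow> ('a \<Rightarrow> 'a) set" where
  "matchings X = {f. (\<forall>u. f (f u) = u) \<and> (\<forall>u\<in>X. f u \<in> X \<and> f u \<noteq> u) \<and> (\<forall>u. u \<notin> X \<longrightarrow> f u = u)}"

text \<open>With \<open>P\<close> the set of outgoing ends at a vertex, these matchings join
  outgoing darts to incoming ones.\<close>

definition crossing_matchings :: "'a set \<Rightarrow> 'a set \<Rightarrow> ('a \<Rightarrow> 'a) set" where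
  "crossing_matchings X P = {f \<in> matchings X. \<forall>u\<in>X. f u \<in> P \<longleftrightarrow> u \<notin> P}"

lemma matchings_permutes: "f \<in> matchings X \<Longrightarrow> f permutes X"
  unfolding matchings_def permutes_def by (auto, metis)

lemma finite_matchings: "finite X \<Longrightarrow> finite (matchings X)"
  by (rule finite_subset[OF _ finite_permutations[of X]]) (auto intro: matchings_permutes)

lemma finite_crossing_matchings: "finite X \<Longrightarrow> finite (crossing_matchings X P)"
  unfolding crossing_matchings_def by (simp add: finite_matchings)

lemma crossing_matchings_card:
  assumes "finite X" "f \<in> crossing_matchings X P"
  shows "card (X \<inter> P) = card (X - P)"
proof (rule bij_betw_same_card)
  show "bij_betw f (X \<inter> P) (X - P)"
    by (rule bij_betw_byWitness[where f' = f])
       (use assms(2) in \<open>auto simp: crossing_matchings_def matchings_def\<close>)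
qed

text \<open>Once a bijection \<open>g\<close> from \<open>P\<close> to \<open>X - P\<close> is
  fixed, a crossing matching amounts to a permutation \<open>q\<close> of \<open>P\<close>: it joins
  \<open>u\<close> in \<open>P\<close> to \<open>g (q u)\<close>.\<close>

lemma card_crossing_matchings:
  assumes "finite X" "P \<subseteq> X" "card P = h" "card X = 2 * h"
  shows "card (crossing_matchings X P) = fact h"
proof -
  have fP: "finite P" using assms finite_subset by blast
  have "card (X - P) = h" using assms fP by (simp add: card_Diff_subset)
  then obtain g where g: "bij_betw g P (X - P)"
    using finite_same_card_bij[OF fP, of "X - P"] assms by auto
  define k where "k = inv_into P g"
  have gk: "\<And>u. u \<in> P \<Longrightarrow> g u \<in> X \<and> g u \<notin> P \<and> k (g u) = u"
    using g unfolding k_def by (auto simp: bij_betw_def)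
  have kg: "\<And>u. u \<in> X \<Longrightarrow> u \<notin> P \<Longrightarrow> k u \<in> P \<and> g (k u) = u"
    using g unfolding k_def
    by (metis DiffI bij_betw_imp_surj_on f_inv_into_f inv_into_into)
  \<comment> \<open>\<open>F\<close> builds the matching from \<open>q\<close>, its values on
    \<open>X - P\<close> being forced by the involution. \<open>B\<close> recovers \<open>q\<close>
    by pulling the partners back to \<open>P\<close>.\<close>
  define F where "F = (\<lambda>q u. if u \<in> P then g (q u) else if u \<in> X then inv q (k u) else u)"
  define B where "B = (\<lambda>(f::'a \<Rightarrow> 'a) u. if u \<in> P then k (f u) else u)"
  have "bij_betw F {q. q permutes P} (crossing_matchings X P)"
  proof (rule bij_betw_byWitness[where f' = B])
    show "\<forall>q\<in>{q. q permutes P}. B (F q) = q"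
      using gk by (auto simp: B_def F_def fun_eq_iff permutes_in_image permutes_not_in)
    show "F ` {q. q permutes P} \<subseteq> crossing_matchings X P"
    proof safe
      fix q assume q: "q permutes P"
      have i: "inv q permutes P" by (rule permutes_inv[OF q])
      have "\<And>u. inv q (q u) = u" "\<And>u. q (inv q u) = u"
        using permutes_inverses[OF q] by auto
      moreover have "g (q u) \<noteq> u" if "u \<in> P" for u
        using gk permutes_in_image[OF q] that by metis
      moreover have "inv q (k u) \<noteq> u" if "u \<in> X" "u \<notin> P" for u
        using kg permutes_in_image[OF i] that by metis
      ultimately show "F q \<in> crossing_matchings X P"
        unfolding crossing_matchings_def matchings_def F_def
        using gk kg permutes_in_image[OF q] permutes_in_image[OF i] assms(2)
        by (auto split: if_splits)
    qed
    have Bp: "B f permutes P" if f: "f \<in> crossing_matchings X P" for f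
    proof (rule bij_imp_permutes)
      show "bij_betw (B f) P P"
        by (rule bij_betw_byWitness[where f' = "\<lambda>u. f (g u)"])
           (use f gk kg assms(2) in \<open>auto simp: B_def crossing_matchings_def matchings_def subset_iff\<close>)
    qed (simp add: B_def)
    show "B ` crossing_matchings X P \<subseteq> {q. q permutes P}" using Bp by auto
    show "\<forall>f\<in>crossing_matchings X P. F (B f) = f"
    proof safe
      fix f assume f: "f \<in> crossing_matchings X P"
      have 1: "inv (B f) (k u) = f u" if "u \<in> X" "u \<notin> P" for u
      proof -
        have "f u \<in> P" using f that by (auto simp: crossing_matchings_def)
        then have "B f (f u) = k u" using f by (simp add: B_def crossing_matchings_def matchings_def)
        then show ?thesis using permutes_inverses(2)[OF Bp[OF f]] by metis
      qed
      show "F (B f) = f"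
      proof
        fix u
        show "F (B f) u = f u"
          using 1[of u] f kg[of "f u"] assms(2)
          by (auto simp: F_def crossing_matchings_def matchings_def) (auto simp: B_def subset_iff)
      qed
    qed
  qed
  then show ?thesis
    using card_permutations[OF assms(3) fP] bij_betw_same_card by fastforce
qed

text \<open>By symmetry the \<open>h\<close> elements on the side opposite to \<open>a\<close> are
  equally likely partners: conjugation by a transposition carries one to another. The inequality
  also covers a \<open>b\<close> that cannot be a partner of \<open>a\<close>.\<close>

lemma crossing_matchings_prescribed:
  assumes "finite X" "P \<subseteq> X" "card P = h" "card X = 2 * h" "a \<in> X"
  shows "h * card {f \<in> crossing_matchings X P. f a = b} \<le> fact h"
proof (cases "{f \<in> crossing_matchings X P. f a = b} = {}")
  case True then show ?thesis by (metis card.empty mult_0_right zero_le)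
next
  case False
  define F where "F = crossing_matchings X P"
  define Q where "Q = (if a \<in> P then X - P else P)"
  have fP: "finite P" using assms finite_subset by blast
  have cQ: "card Q = h" using assms fP by (auto simp: Q_def card_Diff_subset)
  have fF: "finite F" using assms finite_crossing_matchings F_def by auto
  have fQ: "f a \<in> Q" if "f \<in> F" for f
    using that assms by (auto simp: F_def Q_def crossing_matchings_def matchings_def)
  have b: "b \<in> Q" using False fQ by (auto simp: F_def)
  have eq: "card {f \<in> F. f a = b} \<le> card {f \<in> F. f a = c}" if c: "c \<in> Q" for c
  proof (rule card_inj_on_le)
    let ?t = "Transposition.transpose b c"
    let ?T = "\<lambda>f. ?t \<circ> f \<circ> ?t"
    \<comment> \<open>Both \<open>b\<close> and \<open>c\<close> lie on the side opposite to
      \<open>a\<close>, so the transposition preserves both sides and fixes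
      \<open>a\<close>.\<close>
    have tP: "?t u \<in> P \<longleftrightarrow> u \<in> P" and tX: "?t u \<in> X \<longleftrightarrow> u \<in> X" for u
      using b c assms(2) unfolding Q_def
      by (auto simp: Transposition.transpose_def split: if_splits)
    have ta: "?t a = a" using b c assms(5)
      by (auto simp: Q_def Transposition.transpose_def split: if_splits)
    show "inj_on ?T {f \<in> F. f a = b}"
    proof (rule inj_onI)
      fix f f' assume "?T f = ?T f'"
      then have "?t (?T f (?t u)) = ?t (?T f' (?t u))" for u by simp
      then show "f = f'" by (simp add: fun_eq_iff)
    qed
    show "?T ` {f \<in> F. f a = b} \<subseteq> {f \<in> F. f a = c}"
    proof (rule image_subsetI)
      fix f assume f': "f \<in> {f \<in> F. f a = b}"
      then have f: "f \<in> F" by simp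
      then have 1: "\<And>u. f (f u) = u" "\<And>u. u \<in> X \<Longrightarrow> f u \<in> X" "\<And>u. u \<in> X \<Longrightarrow> f u \<noteq> u"
         "\<And>u. u \<notin> X \<Longrightarrow> f u = u" "\<And>u. u \<in> X \<Longrightarrow> f u \<in> P \<longleftrightarrow> u \<notin> P"
        by (auto simp: F_def crossing_matchings_def matchings_def)
      have 2: "?t (f (?t u)) \<noteq> u" if "u \<in> X" for u
        using 1(3)[of "?t u"] tX[of u] that by (metis transpose_involutory)
      have 3: "?t (f (?t u)) = u" if "u \<notin> X" for u
        using 1(4)[of "?t u"] tX[of u] that by (metis transpose_involutory)
      have 4: "?T f (?T f u) = u" for u using 1(1) by simp
      have 5: "?t (f (?t u)) \<in> X" "?t (f (?t u)) \<in> P \<longleftrightarrow> u \<notin> P" if "u \<in> X" for u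
        using 1(2,5)[of "?t u"] tX tP that by blast+
      have "?T f \<in> F"
        unfolding F_def crossing_matchings_def matchings_def
        by (intro CollectI conjI allI ballI impI; (unfold o_apply)?; (rule 2 3 5 4[unfolded o_apply]; assumption?))
      then show "?T f \<in> {f \<in> F. f a = c}" using f' ta by simp
    qed
    show "finite {f \<in> F. f a = c}" using fF by simp
  qed
  have "h * card {f \<in> F. f a = b} = (\<Sum>c\<in>Q. card {f \<in> F. f a = b})" by (simp add: cQ)
  also have "\<dots> \<le> (\<Sum>c\<in>Q. card {f \<in> F. f a = c})" by (rule sum_mono) (rule eq)
  also have "\<dots> = card (\<Union>c\<in>Q. {f \<in> F. f a = c})"
  proof (rule card_UN_disjoint[symmetric])
    show "finite Q" using assms fP by (auto simp: Q_def)
  qed (use fF in auto)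
  also have "\<dots> \<le> card F" by (rule card_mono[OF fF]) auto
  also have "\<dots> = fact h" using card_crossing_matchings[OF assms(1-4)] by (simp add: F_def)
  finally show ?thesis by (simp add: F_def)
qed

text \<open>A toggle injects the fibre of \<phi> over a set into the fibre over that set changed at
  \<open>u\<close>, and likewise back. Hence all fibres over subsets of \<open>U\<close> have the
  same size: \<phi> is uniform on the power set.\<close>

lemma card_fibres_toggle:
  fixes \<phi> :: "'b \<Rightarrow> 'a set"
  assumes "finite F" "finite U" "\<And>A. A \<in> F \<Longrightarrow> \<phi> A \<subseteq> U"
    and tog: "\<And>u. u \<in> U \<Longrightarrow> \<exists>t. inj_on t F \<and> t ` F \<subseteq> F \<and>
      (\<forall>A\<in>F. \<forall>x. x \<in> \<phi> (t A) \<longleftrightarrow> (x \<in> \<phi> A \<longleftrightarrow> x \<noteq> u))"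
  shows "card {A \<in> F. card (\<phi> A) = k} * 2 ^ card U = card F * (card U choose k)"
proof -
  define c where "c X = card {A \<in> F. \<phi> A = X}" for X
  have le: "c X \<le> c Y" if u: "u \<in> U" and XY: "\<And>x. x \<in> Y \<longleftrightarrow> (x \<in> X \<longleftrightarrow> x \<noteq> u)" for u X Y
  proof -
    obtain t where t: "inj_on t F" "t ` F \<subseteq> F"
      "\<forall>A\<in>F. \<forall>x. x \<in> \<phi> (t A) \<longleftrightarrow> (x \<in> \<phi> A \<longleftrightarrow> x \<noteq> u)"
      using tog[OF u] by (elim exE conjE)
    show ?thesis unfolding c_def
    proof (rule card_inj_on_le[where f = t])
      show "inj_on t {A \<in> F. \<phi> A = X}" using t(1) by (rule inj_on_subset) auto
      show "t ` {A \<in> F. \<phi> A = X} \<subseteq> {A \<in> F. \<phi> A = Y}"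
      proof (rule image_subsetI)
        fix A assume A: "A \<in> {A \<in> F. \<phi> A = X}"
        then have "x \<in> \<phi> (t A) \<longleftrightarrow> x \<in> Y" for x using t(3) XY[of x] by simp
        then show "t A \<in> {A \<in> F. \<phi> A = Y}" using A t(2) by auto
      qed
    qed (use assms(1) in auto)
  qed
  have same: "X \<subseteq> U \<Longrightarrow> c X = c {}" for X
  proof (induction X rule: infinite_finite_induct)
    case (infinite X)
    then show ?case using finite_subset[OF _ assms(2)] by blast
  next
    case (insert x X)
    have "c (insert x X) \<le> c X" by (rule le[of x]) (use insert in auto)
    moreover have "c X \<le> c (insert x X)" by (rule le[of x]) (use insert in auto)
    ultimately show ?case using insert by auto
  qed simp
  have "card F = (\<Sum>X\<in>Pow U. c X)"
  proof -
    have "F = (\<Union>X\<in>Pow U. {A \<in> F. \<phi> A = X})" using assms(3) by auto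
    then have "card F = card (\<Union>X\<in>Pow U. {A \<in> F. \<phi> A = X})" by simp
    also have "\<dots> = (\<Sum>X\<in>Pow U. c X)" unfolding c_def
      by (rule card_UN_disjoint) (use assms in auto)
    finally show ?thesis .
  qed
  also have "\<dots> = (\<Sum>X\<in>Pow U. c {})" by (rule sum.cong[OF refl]) (rule same, simp)
  finally have 1: "card F = 2 ^ card U * c {}" using assms(2) by (simp add: card_Pow)
  have "{A \<in> F. card (\<phi> A) = k} = (\<Union>X\<in>{X. X \<subseteq> U \<and> card X = k}. {A \<in> F. \<phi> A = X})"
    using assms(3) by auto
  then have "card {A \<in> F. card (\<phi> A) = k} = card (\<Union>X\<in>{X. X \<subseteq> U \<and> card X = k}. {A \<in> F. \<phi> A = X})"
    by simp
  also have "\<dots> = (\<Sum>X\<in>{X. X \<subseteq> U \<and> card X = k}. c X)" unfolding c_def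
    by (rule card_UN_disjoint) (use assms in auto)
  also have "\<dots> = (\<Sum>X\<in>{X. X \<subseteq> U \<and> card X = k}. c {})"
    by (rule sum.cong[OF refl]) (rule same, simp)
  also have "\<dots> = (card U choose k) * c {}" using assms(2) by (simp add: n_subsets)
  finally show ?thesis using 1 by (simp add: ac_simps)
qed

section \<open>Paths through paired vertices\<close>

text \<open>A regular graph of degree \<open>2 * h\<close> given by its neighbourhoods, so that each
  edge appears as two darts, one from either end.\<close>

locale even_graph =
  fixes V :: "'a set" and N :: "'a \<Rightarrow> 'a set" and h :: nat
  assumes finite_V: "finite V"
    and N_outside: "v \<notin> V \<Longrightarrow> N v = {}"
    and N_sym: "u \<in> N v \<Longrightarrow> v \<in> N u"
    and N_irrefl: "v \<notin> N v"
    and card_N: "v \<in> V \<Longrightarrow> card (N v) = 2 * h"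
    and h_pos: "h > 0"
begin

lemma N_V: "u \<in> N v \<Longrightarrow> u \<in> V \<and> v \<in> V"
  using N_outside N_sym by blast

lemma finite_N: "finite (N v)"
  using finite_subset[OF _ finite_V, of "N v"] N_V by blast

definition darts :: "('a \<times> 'a) set" where
  "darts = {(v, u). u \<in> N v}"

lemma darts_iff [simp]: "(v, u) \<in> darts \<longleftrightarrow> u \<in> N v"
  by (simp add: darts_def)

lemma darts_Sigma: "darts = Sigma V N"
  using N_V by auto

lemma finite_darts: "finite darts"
  by (simp add: darts_Sigma finite_V finite_N)

lemma card_darts: "card darts = card V * (2 * h)"
  by (simp add: darts_Sigma finite_V finite_N card_N)

text \<open>Membership of \<open>(v, u)\<close> means that the edge is directed from
  \<open>v\<close> to \<open>u\<close>.\<close>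

definition orients :: "('a \<times> 'a) set set" where
  "orients = {A. A \<subseteq> darts \<and> (\<forall>v u. u \<in> N v \<longrightarrow> ((u, v) \<in> A \<longleftrightarrow> (v, u) \<notin> A))}"

text \<open>The extensional product leaves no freedom outside \<open>S\<close>, so partial choices
  can be counted and extended by one vertex at a time.\<close>

definition pairings :: "'a set \<Rightarrow> ('a \<Rightarrow> 'a \<Rightarrow> 'a) set" where
  "pairings S = (\<Pi>\<^sub>E v\<in>S. matchings (N v))"

definition compat :: "'a set \<Rightarrow> ('a \<Rightarrow> 'a \<Rightarrow> 'a) \<Rightarrow> ('a \<times> 'a) set set" where
  "compat S p = {A \<in> orients. \<forall>v\<in>S. \<forall>u\<in>N v. (v, p v u) \<in> A \<longleftrightarrow> (v, u) \<notin> A}"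

text \<open>A dart continues from its second end along the edge matched with the one it arrived by.
  Outside \<open>S\<close> it turns back, a default that keeps the map injective.\<close>

definition step :: "'a set \<Rightarrow> ('a \<Rightarrow> 'a \<Rightarrow> 'a) \<Rightarrow> 'a \<times> 'a \<Rightarrow> 'a \<times> 'a" where
  "step S p x = (snd x, if snd x \<in> S then p (snd x) (fst x) else fst x)"

abbreviation walk :: "'a set \<Rightarrow> ('a \<Rightarrow> 'a \<Rightarrow> 'a) \<Rightarrow> 'a \<times> 'a \<Rightarrow> nat \<Rightarrow> 'a \<times> 'a" where
  "walk S p x k \<equiv> (step S p ^^ k) x"

text \<open>The path makes \<open>k\<close> passages through \<open>S\<close>, and the dart with
  index \<open>k\<close> is its last.\<close>

definition exits :: "'a set \<Rightarrow> ('a \<Rightarrow> 'a \<Rightarrow> 'a) \<Rightarrow> 'a \<times> 'a \<Rightarrow> nat \<Rightarrow> bool" where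
  "exits S p x k \<longleftrightarrow> snd (walk S p x k) \<notin> S \<and> (\<forall>j<k. snd (walk S p x j) \<in> S)"

definition loops :: "'a set \<Rightarrow> ('a \<Rightarrow> 'a \<Rightarrow> 'a) \<Rightarrow> 'a \<Rightarrow> 'a set" where
  "loops S p v = {u \<in> N v. \<exists>k. exits S p (v, u) k \<and> snd (walk S p (v, u) k) = v}"

definition free :: "'a set \<Rightarrow> ('a \<Rightarrow> 'a \<Rightarrow> 'a) \<Rightarrow> 'a \<Rightarrow> nat" where
  "free S p v = card (N v - loops S p v)"

section \<open>Walks, their ends and their reversal\<close>

lemma finite_orients: "finite orients"
  by (rule finite_subset[of _ "Pow darts"]) (auto simp: orients_def finite_darts)

lemma finite_compat: "finite (compat S p)"
  by (simp add: compat_def finite_orients)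

lemma step_cong: "(\<And>v. v \<in> S \<Longrightarrow> p v = q v) \<Longrightarrow> step S p = step S q"
  by (auto simp: step_def fun_eq_iff)

lemma free_cong: "(\<And>v. v \<in> S \<Longrightarrow> p v = q v) \<Longrightarrow> free S p = free S q"
proof -
  assume "\<And>v. v \<in> S \<Longrightarrow> p v = q v"
  then have "step S p = step S q" by (rule step_cong)
  then show ?thesis unfolding fun_eq_iff[of "free S p"] free_def loops_def exits_def by simp
qed

lemma pairingsD:
  assumes "p \<in> pairings S" "v \<in> S"
  shows "p v (p v u) = u" "u \<in> N v \<Longrightarrow> p v u \<in> N v" "u \<in> N v \<Longrightarrow> p v u \<noteq> u"
  using assms by (auto simp: pairings_def matchings_def dest!: PiE_mem)

lemma inj_step: "p \<in> pairings S \<Longrightarrow> inj (step S p)"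
proof (rule injI)
  fix x y assume p: "p \<in> pairings S" and *: "step S p x = step S p y"
  then have 1: "snd x = snd y" by (simp add: step_def)
  have "fst x = fst y"
  proof (cases "snd y \<in> S")
    case True
    then have "p (snd y) (fst x) = p (snd y) (fst y)" using * 1 by (simp add: step_def)
    then show ?thesis using pairingsD(1)[OF p True] by metis
  qed (use * 1 in \<open>simp add: step_def\<close>)
  then show "x = y" using 1 by (simp add: prod_eq_iff)
qed

lemma step_darts: "p \<in> pairings S \<Longrightarrow> x \<in> darts \<Longrightarrow> step S p x \<in> darts"
  using N_sym[of "snd x" "fst x"] by (cases x) (simp add: step_def pairingsD(2))

lemma walk_darts: "p \<in> pairings S \<Longrightarrow> x \<in> darts \<Longrightarrow> walk S p x k \<in> darts"
  by (induction k) (auto simp: step_darts)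

lemma fst_walk_Suc: "fst (walk S p x (Suc k)) = snd (walk S p x k)"
  by (simp add: step_def)

lemma exits_unique: "exits S p x k \<Longrightarrow> exits S p x l \<Longrightarrow> k = l"
  unfolding exits_def by (meson linorder_neqE_nat)

text \<open>Iterating an injective map on the finite set of darts leads back to \<open>x\<close>,
  and the dart just before \<open>x\<close> ends at \<open>fst x\<close>, outside
  \<open>S\<close>.\<close>

lemma exits_exists:
  assumes "p \<in> pairings S" "x \<in> darts" "fst x \<notin> S"
  shows "\<exists>k. exits S p x k"
proof -
  have "\<exists>k. snd (walk S p x k) \<notin> S"
  proof (rule ccontr)
    assume *: "\<not> ?thesis"
    have "finite {y. \<exists>n. y = (step S p ^^ n) x}"
      by (rule finite_subset[OF _ finite_darts]) (use walk_darts[OF assms(1,2)] in blast)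
    then obtain n where n: "n > 0" "(step S p ^^ n) x = x"
      using funpow_inj_finite[OF inj_step[OF assms(1)]] by metis
    then obtain m where "n = Suc m" by (cases n) auto
    then have "fst x = snd (walk S p x m)" using n fst_walk_Suc by metis
    then show False using * assms(3) by auto
  qed
  then show ?thesis using exists_least_iff[of "\<lambda>k. snd (walk S p x k) \<notin> S"] by (auto simp: exits_def)
qed

text \<open>Each matching is an involution, so the reversed last dart retraces the path.\<close>

lemma walk_reverse:
  assumes "p \<in> pairings S" "exits S p x k" "j \<le> k"
  shows "walk S p (prod.swap (walk S p x k)) j = prod.swap (walk S p x (k - j))"
  using assms(3)
proof (induction j)
  case (Suc j)
  define m where "m = k - Suc j"
  have m: "k - j = Suc m" "m < k" using Suc by (auto simp: m_def)
  obtain a b where ab: "walk S p x m = (a, b)" by fastforce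
  have b: "b \<in> S" using assms(2) m ab by (auto simp: exits_def)
  have 1: "walk S p x (Suc m) = (b, p b a)" using ab b by (simp add: step_def)
  have "walk S p (prod.swap (walk S p x k)) (Suc j) = step S p (prod.swap (walk S p x (Suc m)))"
    using Suc m by simp
  also have "\<dots> = (b, a)" unfolding 1 using b by (simp add: step_def pairingsD[OF assms(1)])
  finally show ?case using ab m_def by simp
qed simp

lemma exits_reverse:
  assumes "p \<in> pairings S" "exits S p x k" "fst x \<notin> S"
  shows "exits S p (prod.swap (walk S p x k)) k"
  unfolding exits_def
proof (intro conjI allI impI)
  show "snd (walk S p (prod.swap (walk S p x k)) k) \<notin> S"
    using walk_reverse[OF assms(1,2), of k] assms(3) by simp
next
  fix j assume j: "j < k"
  define m where "m = k - Suc j"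
  have m: "k - j = Suc m" "m < k" using j by (auto simp: m_def)
  show "snd (walk S p (prod.swap (walk S p x k)) j) \<in> S"
    using walk_reverse[OF assms(1,2), of j] j m assms(2) fst_walk_Suc[where x = x and k = m]
    by (simp add: exits_def del: funpow.simps)
qed

lemma compat_orients: "A \<in> compat S p \<Longrightarrow> u \<in> N v \<Longrightarrow> (u, v) \<in> A \<longleftrightarrow> (v, u) \<notin> A"
  by (auto simp: compat_def orients_def)

lemma compatD: "A \<in> compat S p \<Longrightarrow> v \<in> S \<Longrightarrow> u \<in> N v \<Longrightarrow> (v, p v u) \<in> A \<longleftrightarrow> (v, u) \<notin> A"
  by (auto simp: compat_def)

text \<open>At a vertex of \<open>S\<close> the matched edges are one incoming and one outgoing, so
  the direction is passed on from dart to dart.\<close>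

lemma walk_orient:
  assumes "p \<in> pairings S" "A \<in> compat S p" "x \<in> darts" "\<And>j. j < k \<Longrightarrow> snd (walk S p x j) \<in> S"
  shows "walk S p x k \<in> A \<longleftrightarrow> x \<in> A"
  using assms(4)
proof (induction k)
  case (Suc k)
  obtain a b where ab: "walk S p x k = (a, b)" by fastforce
  have "(a, b) \<in> darts" using walk_darts[OF assms(1,3), of k] ab by simp
  then have N: "b \<in> N a" "a \<in> N b" using N_sym[of b a] by auto
  have b: "b \<in> S" using Suc.prems[of k] ab by simp
  have "walk S p x (Suc k) = (b, p b a)" using ab b by (simp add: step_def)
  then have "walk S p x (Suc k) \<in> A \<longleftrightarrow> (a, b) \<in> A"
    using compatD[OF assms(2) b N(2)] compat_orients[OF assms(2) N(1)] by simp
  then show ?case using Suc ab by simp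
qed simp

section \<open>Outgoing darts, returning paths and path reversals\<close>

definition outs :: "('a \<times> 'a) set \<Rightarrow> 'a \<Rightarrow> 'a set" where
  "outs A v = {u \<in> N v. (v, u) \<in> A}"

text \<open>The two ends of a path from \<open>v\<close> back to \<open>v\<close> are oriented oppositely.\<close>

lemma loops_balanced:
  assumes p: "p \<in> pairings S" and A: "A \<in> compat S p" and v: "v \<notin> S"
  shows "card (loops S p v) = 2 * card (loops S p v \<inter> outs A v)"
proof -
  define L where "L = loops S p v"
  define ex where "ex u = (THE k. exits S p (v, u) k)" for u
  \<comment> \<open>The path ends with the dart \<open>(mate u, v)\<close>: the mate is the
    neighbour through which it returns to \<open>v\<close>.\<close>
  define mate where "mate u = fst (walk S p (v, u) (ex u))" for u
  have ex: "ex u = k" if "exits S p (v, u) k" for u k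
    unfolding ex_def by (rule the_equality) (use that exits_unique in auto)
  have main: "mate u \<in> L \<and> mate (mate u) = u \<and> ((v, mate u) \<in> A \<longleftrightarrow> (v, u) \<notin> A)" if u: "u \<in> L" for u
  proof -
    obtain k where k: "exits S p (v, u) k" "snd (walk S p (v, u) k) = v" and uN: "u \<in> N v"
      using u by (auto simp: L_def loops_def)
    have ek: "ex u = k" using ex k by simp
    have w: "walk S p (v, u) k = (mate u, v)" using k ek by (simp add: mate_def prod_eq_iff)
    have mN: "v \<in> N (mate u)" "mate u \<in> N v"
      using walk_darts[OF p, of "(v, u)" k] w uN N_sym[of v "mate u"] by auto
    have e2: "exits S p (v, mate u) k"
      using exits_reverse[OF p k(1)] w v by simp
    have w2: "walk S p (v, mate u) k = (u, v)"
      using walk_reverse[OF p k(1), of k] w by simp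
    have "mate u \<in> L" using e2 w2 mN by (auto simp: L_def loops_def)
    moreover have "mate (mate u) = u" using ex[OF e2] w2 by (simp add: mate_def[of "mate u"])
    moreover have "(mate u, v) \<in> A \<longleftrightarrow> (v, u) \<in> A"
      using walk_orient[OF p A, of "(v, u)" k] uN k(1) w by (auto simp: exits_def)
    ultimately show ?thesis using compat_orients[OF A mN(2)] by blast
  qed
  have LN: "L \<subseteq> N v" by (auto simp: L_def loops_def)
  have fL: "finite L" using finite_subset[OF LN finite_N] .
  have "bij_betw mate (L \<inter> outs A v) (L - outs A v)"
    by (rule bij_betw_byWitness[where f' = mate]) (use main LN in \<open>auto simp: outs_def\<close>)
  then have "card (L \<inter> outs A v) = card (L - outs A v)" by (rule bij_betw_same_card)
  moreover have "card L = card (L \<inter> outs A v) + card (L - outs A v)"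
    using card_Int_Diff[OF fL] .
  ultimately show ?thesis by (simp add: L_def)
qed

text \<open>Reversing the whole path that starts at a dart of \<open>v\<close> and ends elsewhere changes
  the orientation of no other edge at \<open>v\<close>.\<close>

lemma toggle_exists:
  assumes p: "p \<in> pairings S" and v: "v \<notin> S" and u: "u \<in> N v - loops S p v"
  shows "\<exists>t. inj_on t (compat S p) \<and> t ` compat S p \<subseteq> compat S p \<and>
    (\<forall>A\<in>compat S p. \<forall>a. a \<in> outs (t A) v - loops S p v \<longleftrightarrow>
      (a \<in> outs A v - loops S p v \<longleftrightarrow> a \<noteq> u))"
proof -
  have uN: "u \<in> N v" using u by simp
  obtain k where k: "exits S p (v, u) k" using exits_exists[OF p, of "(v, u)"] uN v by auto
  have nv: "snd (walk S p (v, u) k) \<noteq> v" using u k by (auto simp: loops_def)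
  \<comment> \<open>\<open>K\<close> holds both darts of every edge on the path, and
    \<open>t\<close> reverses exactly these edges.\<close>
  define K where "K = {(a, b). \<exists>j\<le>k. walk S p (v, u) j = (a, b) \<or> walk S p (v, u) j = (b, a)}"
  define t where "t A = {x \<in> darts. x \<in> A \<longleftrightarrow> x \<notin> K}" for A
  have Kiff: "(a, b) \<in> K \<longleftrightarrow>
      (\<exists>j\<le>k. walk S p (v, u) j = (a, b)) \<or> (\<exists>j\<le>k. walk S p (v, u) j = (b, a))" for a b
    by (auto simp: K_def)
  have Ksym: "(a, b) \<in> K \<longleftrightarrow> (b, a) \<in> K" for a b using Kiff by blast
  \<comment> \<open>Of two edges matched at a vertex of \<open>S\<close>, both are reversed or
    neither is, so compatibility survives.\<close>
  have Kcl: "(w, p w a) \<in> K" if wa: "(w, a) \<in> K" and w: "w \<in> S" for w a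
  proof -
    consider (fwd) j where "j \<le> k" "walk S p (v, u) j = (w, a)"
      | (bwd) j where "j \<le> k" "walk S p (v, u) j = (a, w)"
      using wa Kiff by blast
    then show ?thesis
    proof cases
      case fwd
      have "j \<noteq> 0" using fwd w v by (metis fst_conv funpow_0)
      then obtain i where i: "j = Suc i" using not0_implies_Suc by blast
      obtain b where b: "walk S p (v, u) i = (b, w)"
        using fst_walk_Suc[of i S p "(v, u)"] fwd i by (metis fst_conv prod.collapse)
      have "(w, a) = (w, p w b)" using fwd i b w by (simp add: step_def)
      then have "p w a = b" using pairingsD[OF p w] by simp
      moreover have "i \<le> k" using fwd i by simp
      ultimately show ?thesis using b Kiff by blast
    next
      case bwd
      have "j \<noteq> k" using bwd k w by (auto simp: exits_def)
      then have "Suc j \<le> k" using bwd by simp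
      moreover have "walk S p (v, u) (Suc j) = (w, p w a)" using bwd w by (simp add: step_def)
      ultimately show ?thesis using Kiff by blast
    qed
  qed
  \<comment> \<open>Since \<open>v\<close> is outside \<open>S\<close>, the path meets it at most at
    its two ends, and by the choice of \<open>u\<close> the far end is elsewhere.\<close>
  have Kv: "(v, a) \<in> K \<longleftrightarrow> a = u" for a
  proof
    assume "a = u" then show "(v, a) \<in> K"
      using Kiff[of v u] by (auto intro: exI[of _ 0])
  next
    assume "(v, a) \<in> K"
    then consider (fwd) j where "j \<le> k" "walk S p (v, u) j = (v, a)"
      | (bwd) j where "j \<le> k" "walk S p (v, u) j = (a, v)"
      using Kiff by blast
    then show "a = u"
    proof cases
      case fwd
      have "j = 0"
      proof (rule ccontr)
        assume "j \<noteq> 0"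
        then obtain i where i: "j = Suc i" using not0_implies_Suc by blast
        have "snd (walk S p (v, u) i) = v" using fst_walk_Suc[of i S p "(v, u)"] fwd i by simp
        then show False using k i fwd v by (auto simp: exits_def Suc_le_eq)
      qed
      then show ?thesis using fwd by simp
    next
      case bwd
      then have "j = k" using k v unfolding exits_def by (metis le_neq_implies_less snd_conv)
      then show ?thesis using bwd nv by simp
    qed
  qed
  have tt: "t (t A) = A" if "A \<in> compat S p" for A
  proof -
    have "A \<subseteq> darts" using that by (simp add: compat_def orients_def)
    then show ?thesis by (auto simp: t_def)
  qed
  have tc: "t A \<in> compat S p" if A: "A \<in> compat S p" for A
    unfolding compat_def orients_def
  proof (intro CollectI conjI allI impI ballI)
    fix w a assume a: "a \<in> N w"
    then show "(a, w) \<in> t A \<longleftrightarrow> (w, a) \<notin> t A"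
      using compat_orients[OF A a] Ksym[of a w] N_sym[OF a] a by (auto simp: t_def)
  next
    fix w a assume w: "w \<in> S" and a: "a \<in> N w"
    have "(w, p w a) \<in> K \<longleftrightarrow> (w, a) \<in> K"
      using Kcl[of w a] Kcl[of w "p w a"] w unfolding pairingsD(1)[OF p w] by blast
    then show "(w, p w a) \<in> t A \<longleftrightarrow> (w, a) \<notin> t A"
      using compatD[OF A w a] a pairingsD(2)[OF p w a] by (auto simp: t_def)
  qed (auto simp: t_def)
  show ?thesis
  proof (intro exI[of _ t] conjI ballI allI)
    show "inj_on t (compat S p)" by (rule inj_on_inverseI[of _ t]) (rule tt)
    show "t ` compat S p \<subseteq> compat S p" using tc by auto
    fix A a assume A: "A \<in> compat S p"
    show "a \<in> outs (t A) v - loops S p v \<longleftrightarrow> (a \<in> outs A v - loops S p v \<longleftrightarrow> a \<noteq> u)"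
      using u Kv[of a] by (auto simp: outs_def t_def)
  qed
qed

end

section \<open>The probability of being balanced\<close>

definition balance_prob :: "nat \<Rightarrow> real" where
  "balance_prob s = real (s choose (s div 2)) / 2 ^ s"

lemma balance_prob_pos: "balance_prob s > 0"
  by (simp add: balance_prob_def)

text \<open>The absorption identity is used twice, with the symmetry of
  \<open>2 * k + 1 choose k\<close> in between. The result gives the ratio of consecutive values of
  \<open>balance_prob\<close>.\<close>

lemma central_binomial_Suc:
  "real (Suc k) * real (2 * Suc k choose Suc k) = 2 * real (2 * k + 1) * real (2 * k choose k)"
proof -
  have 1: "Suc k * (2 * Suc k choose Suc k) = 2 * Suc k * (2 * k + 1 choose k)"
    using Suc_times_binomial_eq[of "2 * k + 1" k] by simp
  then have 1: "(2 * Suc k choose Suc k) = 2 * (2 * k + 1 choose k)"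
    by (metis mult.assoc mult.commute mult_cancel1 nat.distinct(1))
  have "(2 * k + 1 choose k) = (2 * k + 1 choose Suc k)"
    using binomial_symmetric[of k "2 * k + 1"] by simp
  moreover have "Suc k * (2 * k + 1 choose Suc k) = (2 * k + 1) * (2 * k choose k)"
    using Suc_times_binomial_eq[of "2 * k" k] by simp
  ultimately have "Suc k * (2 * Suc k choose Suc k) = 2 * ((2 * k + 1) * (2 * k choose k))"
    using 1 by (metis mult.left_commute)
  then have "real (Suc k * (2 * Suc k choose Suc k)) = real (2 * ((2 * k + 1) * (2 * k choose k)))"
    by (rule arg_cong)
  then show ?thesis by (simp only: of_nat_mult of_nat_numeral mult.assoc)
qed

lemma balance_prob_Suc:
  "balance_prob (2 * Suc k) = balance_prob (2 * k) * (real (2 * k + 1) / real (2 * k + 2))"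
proof -
  have "balance_prob (2 * Suc k) = real (2 * Suc k choose Suc k) / 2 ^ (2 * Suc k)"
    unfolding balance_prob_def nonzero_mult_div_cancel_left[OF numeral_neq_zero] ..
  moreover have "(2 ^ (2 * Suc k) :: real) = 4 * 2 ^ (2 * k)" by simp
  moreover have "real (2 * Suc k choose Suc k) = 2 * real (2 * k + 1) * real (2 * k choose k) / real (Suc k)"
    by (subst central_binomial_Suc[of k, symmetric]) (simp del: binomial_Suc_Suc)
  moreover have "2 * a * b / s / (4 * c) = b / c * (a / (2 * s))" for a b c s :: real
    by (simp add: field_simps)
  moreover have "real (2 * k + 2) = 2 * real (Suc k)" by simp
  ultimately show ?thesis by (simp only: balance_prob_def nonzero_mult_div_cancel_left[OF numeral_neq_zero])
qed

lemma ln_balance_prob_Suc: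
  "ln (balance_prob (2 * Suc k)) = ln (balance_prob (2 * k)) + ln (real (2 * k + 1) / real (2 * k + 2))"
  unfolding balance_prob_Suc by (rule ln_mult_pos) (simp_all add: balance_prob_pos)

lemma balance_prob_antimono: "k \<le> m \<Longrightarrow> balance_prob (2 * m) \<le> balance_prob (2 * k)"
proof (induction m rule: dec_induct)
  case (step m)
  have "balance_prob (2 * Suc m) \<le> balance_prob (2 * m) * 1"
    unfolding balance_prob_Suc by (rule mult_left_mono) (simp_all add: balance_prob_pos less_imp_le)
  then show ?case using step by simp
qed simp

text \<open>The increments of \<open>k \<mapsto> ln (balance_prob (2 * k))\<close> increase, so this
  function is convex; it vanishes at \<open>0\<close>.\<close>

lemma ln_balance_prob_convex:
  assumes "k \<le> m"
  shows "real m * ln (balance_prob (2 * k)) \<le> real k * ln (balance_prob (2 * m))"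
proof -
  define b where "b k = ln (balance_prob (2 * k))" for k
  define e where "e k = ln (real (2 * k + 1) / real (2 * k + 2))" for k
  have bS: "b (Suc k) = b k + e k" for k unfolding b_def e_def by (rule ln_balance_prob_Suc)
  have b0: "b 0 = 0" by (simp add: b_def balance_prob_def)
  have e: "e k \<le> e (Suc k)" for k
    unfolding e_def by (intro iffD2[OF ln_le_cancel_iff]) (auto simp: field_simps)
  \<comment> \<open>\<open>b k\<close> is the sum of the first \<open>k\<close> increments, none of
    which exceeds \<open>e k\<close>.\<close>
  have 1: "b k \<le> real k * e k" for k
  proof (induction k)
    case (Suc k)
    have "b (Suc k) \<le> real (Suc k) * e k" using Suc bS[of k] by (simp add: algebra_simps)
    also have "\<dots> \<le> real (Suc k) * e (Suc k)" by (rule mult_left_mono[OF e]) simp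
    finally show ?case .
  qed (simp add: b0)
  \<comment> \<open>For positive \<open>k\<close> this says that the slope \<open>b k / k\<close> of
    the chord from the origin increases.\<close>
  have 2: "real (Suc k) * b k \<le> real k * b (Suc k)" for k
    using 1[of k] bS[of k] by (simp add: algebra_simps)
  have "real m * b k \<le> real k * b m"
    using assms
  proof (induction m rule: dec_induct)
    case (step m)
    show ?case
    proof (cases "k = 0")
      case False
      then have m: "real m > 0" using step by simp
      have "real m * (real (Suc m) * b k) \<le> real (Suc m) * (real k * b m)"
        using mult_left_mono[OF step.IH, of "real (Suc m)"] by (simp add: algebra_simps)
      also have "\<dots> = real k * (real (Suc m) * b m)" by simp
      also have "\<dots> \<le> real k * (real m * b (Suc m))" by (rule mult_left_mono[OF 2]) simp
      finally have "real m * (real (Suc m) * b k) \<le> real m * (real k * b (Suc m))"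
        by (simp add: algebra_simps)
      then show ?thesis using m by (rule mult_left_le_imp_le)
    qed (simp add: b0)
  qed simp
  then show ?thesis by (simp add: b_def)
qed

text \<open>The central binomial coefficient is at least \<open>4 ^ m / (2 * m)\<close>. This is the
  source of the factor \<open>ln d\<close> in the error.\<close>

lemma ln_balance_prob_lower:
  assumes "m > 0" shows "- ln (balance_prob (2 * m)) \<le> ln (real (2 * m))"
proof -
  have "(4::real) ^ m / (2 * real m) \<le> real (2 * m choose m)"
    using central_binomial_lower_bound[OF assms] .
  then have "1 / real (2 * m) \<le> balance_prob (2 * m)"
    using assms power_mult[of "2::real" 2 m] by (simp add: balance_prob_def field_simps)
  then have "ln (1 / real (2 * m)) \<le> ln (balance_prob (2 * m))"
    using assms by (simp add: balance_prob_pos)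
  then show ?thesis using assms by (simp add: ln_div)
qed

text \<open>Jensen's inequality: the mean of \<open>ln (1 / w x)\<close> is at most the logarithm of
  the mean of \<open>1 / w x\<close>.\<close>

lemma sum_ln_inverse_le:
  fixes w :: "'b \<Rightarrow> real"
  assumes "finite X" "X \<noteq> {}" "\<And>x. x \<in> X \<Longrightarrow> w x > 0"
  shows "real (card X) * (ln (real (card X)) - ln (\<Sum>x\<in>X. 1 / w x)) \<le> (\<Sum>x\<in>X. ln (w x))"
proof -
  define T where "T = (\<Sum>x\<in>X. 1 / w x)"
  define c where "c = real (card X)"
  have T: "T > 0" unfolding T_def by (rule sum_pos) (use assms in auto)
  have c: "c > 0" using assms by (simp add: c_def card_gt_0_iff)
  have "(\<Sum>x\<in>X. ln c - ln T - ln (w x)) \<le> (\<Sum>x\<in>X. c / T * (1 / w x) - 1)"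
  proof (rule sum_mono)
    fix x assume "x \<in> X"
    then have w: "w x > 0" by (rule assms)
    \<comment> \<open>The numbers \<open>1 / w x\<close> are scaled to have mean 1, so that the
      bounds \<open>y - 1\<close> sum to 0.\<close>
    have "ln (c / T * (1 / w x)) \<le> c / T * (1 / w x) - 1"
      by (rule ln_le_minus_one) (use T c w in simp)
    moreover have "ln (c / T * (1 / w x)) = ln c - ln T - ln (w x)"
      using T c w by (simp add: ln_div ln_mult)
    ultimately show "ln c - ln T - ln (w x) \<le> c / T * (1 / w x) - 1" by simp
  qed
  also have "\<dots> = c / T * T - c" unfolding sum_subtractf sum_distrib_left[symmetric] T_def[symmetric] by (simp add: c_def)
  also have "\<dots> = 0" using T by simp
  finally show ?thesis unfolding sum_subtractf T_def[symmetric] c_def[symmetric]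
    by (simp add: c_def[symmetric] right_diff_distrib)
qed

section \<open>Orientations compatible with matchings at some vertices\<close>

context even_graph
begin

lemma outs_sub: "outs A v \<subseteq> N v" by (auto simp: outs_def)

lemma finite_outs: "finite (outs A v)" using finite_subset[OF outs_sub finite_N] .

lemma loops_sub: "loops S p v \<subseteq> N v" by (auto simp: loops_def)

lemma card_outs_split:
  "card (outs A v) = card (loops S p v \<inter> outs A v) + card (outs A v - loops S p v)"
  using card_Int_Diff[OF finite_outs, of A v "loops S p v"] by (simp add: Int_commute)

text \<open>Exactly half of the returning darts are outgoing; in particular
  \<open>free S p v\<close> is even.\<close>

lemma free_eq:
  assumes "p \<in> pairings S" "A \<in> compat S p" "v \<notin> S" "v \<in> V"
  shows "free S p v + 2 * card (loops S p v \<inter> outs A v) = 2 * h"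
proof -
  have "free S p v = 2 * h - card (loops S p v)"
    unfolding free_def using card_Diff_subset[OF finite_subset[OF loops_sub finite_N] loops_sub]
    by (simp add: card_N assms)
  moreover have "card (loops S p v) \<le> 2 * h"
    using card_mono[OF finite_N loops_sub] card_N[OF assms(4)] by metis
  ultimately show ?thesis using loops_balanced[OF assms(1-3)] by simp
qed

text \<open>Returning darts contribute equally to both directions, so \<open>v\<close> is balanced
  exactly when half of its free darts are outgoing. Path reversals make the set of outgoing free
  darts uniform.\<close>

lemma balanced_count:
  assumes p: "p \<in> pairings S" and v: "v \<notin> S" "v \<in> V"
  shows "real (card {A \<in> compat S p. card (outs A v) = h}) =
    real (card (compat S p)) * balance_prob (free S p v)"
proof -
  let ?s = "free S p v"
  define \<phi> where "\<phi> A = outs A v - loops S p v" for A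
  have "card {A \<in> compat S p. card (\<phi> A) = ?s div 2} * 2 ^ card (N v - loops S p v)
      = card (compat S p) * (card (N v - loops S p v) choose (?s div 2))"
  proof (rule card_fibres_toggle)
    show "finite (N v - loops S p v)" using finite_N by simp
    show "\<phi> A \<subseteq> N v - loops S p v" for A using outs_sub by (auto simp: \<phi>_def)
  qed (use toggle_exists[OF p v(1)] finite_compat in \<open>simp_all add: \<phi>_def\<close>)
  moreover have "{A \<in> compat S p. card (\<phi> A) = ?s div 2} = {A \<in> compat S p. card (outs A v) = h}"
  proof (rule Collect_cong, rule conj_cong[OF refl])
    fix A assume A: "A \<in> compat S p"
    show "card (\<phi> A) = ?s div 2 \<longleftrightarrow> card (outs A v) = h"
      using free_eq[OF p A v] card_outs_split[of A v S p] unfolding \<phi>_def by linarith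
  qed
  ultimately have "real (card {A \<in> compat S p. card (outs A v) = h} * 2 ^ ?s)
      = real (card (compat S p) * (?s choose (?s div 2)))"
    by (simp only: free_def[symmetric])
  then show ?thesis by (simp add: balance_prob_def field_simps)
qed

lemma crossing_outs_empty:
  assumes "v \<in> V" "card (outs A v) \<noteq> h" shows "crossing_matchings (N v) (outs A v) = {}"
proof (rule ccontr)
  assume "\<not> ?thesis"
  then obtain f where "f \<in> crossing_matchings (N v) (outs A v)" by blast
  then have "card (N v \<inter> outs A v) = card (N v - outs A v)"
    by (rule crossing_matchings_card[OF finite_N])
  moreover have "card (N v) = card (N v \<inter> outs A v) + card (N v - outs A v)"
    by (rule card_Int_Diff[OF finite_N])
  moreover have "N v \<inter> outs A v = outs A v" using outs_sub by blast
  ultimately show False using assms card_N[of v] by simp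
qed

lemma card_crossing_outs:
  assumes "v \<in> V"
  shows "card (crossing_matchings (N v) (outs A v)) = (if card (outs A v) = h then fact h else 0)"
  using card_crossing_matchings[OF finite_N outs_sub _ card_N[OF assms], of A] crossing_outs_empty[OF assms, of A]
  by auto

lemma crossing_outs_iff:
  "f \<in> crossing_matchings (N v) (outs A v) \<longleftrightarrow>
    f \<in> matchings (N v) \<and> (\<forall>u\<in>N v. (v, f u) \<in> A \<longleftrightarrow> (v, u) \<notin> A)"
  by (auto simp: crossing_matchings_def outs_def matchings_def)

lemma compat_insert:
  assumes "v \<notin> S" "f \<in> matchings (N v)"
  shows "compat (insert v S) (p(v := f)) =
    {A \<in> compat S p. f \<in> crossing_matchings (N v) (outs A v)}"
proof -
  have "(p(v := f)) w = p w" if "w \<in> S" for w using that assms(1) by auto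
  then show ?thesis
    using assms unfolding crossing_outs_iff compat_def
    by (auto simp del: fun_upd_apply simp: fun_upd_same)
qed

text \<open>Double counting of orientations and matchings at \<open>v\<close>: an orientation
  balanced at \<open>v\<close> admits \<open>fact h\<close> crossing matchings, any other
  none.\<close>

lemma sum_compat_insert:
  assumes p: "p \<in> pairings S" and v: "v \<notin> S" "v \<in> V"
  shows "(\<Sum>f\<in>matchings (N v). real (card (compat (insert v S) (p(v := f))))) =
    real (card (compat S p)) * (fact h * balance_prob (free S p v))"
proof -
  have "(\<Sum>f\<in>matchings (N v). card (compat (insert v S) (p(v := f))))
      = (\<Sum>f\<in>matchings (N v). card {A \<in> compat S p. f \<in> crossing_matchings (N v) (outs A v)})"
    using compat_insert[OF v(1)] by simp
  also have "\<dots> = (\<Sum>A\<in>compat S p. card {f \<in> matchings (N v). f \<in> crossing_matchings (N v) (outs A v)})"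
    using sum.swap_restrict[of "matchings (N v)" "compat S p" "\<lambda>_ _. 1::nat"
        "\<lambda>f A. f \<in> crossing_matchings (N v) (outs A v)"] finite_matchings[OF finite_N] finite_compat
    by simp
  also have "\<dots> = (\<Sum>A\<in>compat S p. if card (outs A v) = h then fact h else 0)"
  proof (rule sum.cong[OF refl])
    fix A
    have "{f \<in> matchings (N v). f \<in> crossing_matchings (N v) (outs A v)} = crossing_matchings (N v) (outs A v)"
      by (auto simp: crossing_matchings_def)
    then show "card {f \<in> matchings (N v). f \<in> crossing_matchings (N v) (outs A v)} =
        (if card (outs A v) = h then fact h else 0)"
      using card_crossing_outs[OF v(2), of A] by simp
  qed
  also have "\<dots> = card {A \<in> compat S p. card (outs A v) = h} * fact h"
    by (simp add: sum.If_cases finite_compat Int_def)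
  finally have "(\<Sum>f\<in>matchings (N v). card (compat (insert v S) (p(v := f)))) =
     card {A \<in> compat S p. card (outs A v) = h} * fact h" .
  then have "real (\<Sum>f\<in>matchings (N v). card (compat (insert v S) (p(v := f)))) =
     real (card {A \<in> compat S p. card (outs A v) = h} * fact h)" by (rule arg_cong)
  then show ?thesis using balanced_count[OF p v] by simp
qed

section \<open>Choosing the matchings in a given order of the vertices\<close>

definition below :: "('a \<Rightarrow> nat) \<Rightarrow> 'a \<Rightarrow> 'a set" where
  "below pos v = {w \<in> V. pos w < pos v}"

text \<open>Summing over the matching at the next vertex multiplies the count by exactly the new
  factor of the denominator, so the sum keeps its initial value, as in Kraft's equality for codes. A
  threshold that no vertex attains changes nothing.\<close>

lemma kraft_below:
  assumes inj: "inj_on pos V"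
  shows "(\<Sum>p\<in>pairings {w \<in> V. pos w < k}. real (card (compat {w \<in> V. pos w < k} p)) /
      (\<Prod>v\<in>{w \<in> V. pos w < k}. fact h * balance_prob (free (below pos v) p v))) = real (card orients)"
proof (induction k)
  case 0
  show ?case by (simp add: pairings_def compat_def)
next
  case (Suc k)
  define S where "S = {w \<in> V. pos w < k}"
  show ?case
  proof (cases "\<exists>v\<in>V. pos v = k")
    case False
    then have "{w \<in> V. pos w < Suc k} = S" by (auto simp: S_def less_Suc_eq)
    then show ?thesis using Suc by (simp add: S_def)
  next
    case True
    then obtain v where v: "v \<in> V" "pos v = k" by blast
    have eq: "{w \<in> V. pos w < Suc k} = insert v S"
      using v inj by (auto simp: S_def less_Suc_eq inj_on_def)
    have vS: "v \<notin> S" using v by (auto simp: S_def)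
    have bv: "below pos v = S" using v by (simp add: below_def S_def)
    have bw: "below pos w \<subseteq> S" if "w \<in> S" for w using that by (auto simp: below_def S_def)
    have fS: "finite S" using finite_V by (simp add: S_def)
    define W where "W p = (\<Prod>w\<in>S. fact h * balance_prob (free (below pos w) p w))" for p
    \<comment> \<open>Each factor depends only on the matchings at earlier vertices, so the matching
      chosen at \<open>v\<close> affects none of those present so far.\<close>
    have WW: "(\<Prod>w\<in>insert v S. fact h * balance_prob (free (below pos w) (p(v := f)) w))
        = fact h * balance_prob (free S p v) * W p" for p f
    proof -
      have "free (below pos w) (p(v := f)) = free (below pos w) p" if "w \<in> insert v S" for w
        by (rule free_cong) (use that bw bv vS in auto)
      then show ?thesis using vS fS by (simp add: W_def bv)
    qed
    have "(\<Sum>p\<in>pairings (insert v S). real (card (compat (insert v S) p)) /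
        (\<Prod>w\<in>insert v S. fact h * balance_prob (free (below pos w) p w)))
      = (\<Sum>(f, p)\<in>matchings (N v) \<times> pairings S. real (card (compat (insert v S) (p(v := f)))) /
        (\<Prod>w\<in>insert v S. fact h * balance_prob (free (below pos w) (p(v := f)) w)))"
      unfolding pairings_def PiE_insert_eq
      by (subst sum.reindex[OF inj_combinator[OF vS]]) (simp add: case_prod_beta')
    also have "\<dots> = (\<Sum>p\<in>pairings S. \<Sum>f\<in>matchings (N v). real (card (compat (insert v S) (p(v := f)))) /
        (\<Prod>w\<in>insert v S. fact h * balance_prob (free (below pos w) (p(v := f)) w)))"
      unfolding sum.cartesian_product[symmetric] by (rule sum.swap)
    also have "\<dots> = (\<Sum>p\<in>pairings S. (\<Sum>f\<in>matchings (N v). real (card (compat (insert v S) (p(v := f))))) /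
        (fact h * balance_prob (free S p v) * W p))"
      unfolding WW by (simp add: sum_divide_distrib)
    also have "\<dots> = (\<Sum>p\<in>pairings S. real (card (compat S p)) / W p)"
    proof (rule sum.cong[OF refl])
      fix p assume p: "p \<in> pairings S"
      show "(\<Sum>f\<in>matchings (N v). real (card (compat (insert v S) (p(v := f))))) /
        (fact h * balance_prob (free S p v) * W p) = real (card (compat S p)) / W p"
        unfolding sum_compat_insert[OF p vS v(1)]
        using balance_prob_pos[of "free S p v"] by simp
    qed
    also have "\<dots> = real (card orients)" using Suc by (simp add: W_def S_def)
    finally show ?thesis unfolding eq .
  qed
qed

text \<open>Grouped by orientation, because for fixed \<open>A\<close> the matchings at different
  vertices are independent choices.\<close>

definition configs :: "(('a \<times> 'a) set \<times> ('a \<Rightarrow> 'a \<Rightarrow> 'a)) set" where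
  "configs = (SIGMA A:orients. {p \<in> pairings V. A \<in> compat V p})"

lemma finite_pairings: "finite (pairings V)"
  unfolding pairings_def by (intro finite_PiE finite_V finite_matchings finite_N)

lemma finite_configs: "finite configs"
  unfolding configs_def by (intro finite_SigmaI finite_orients) (simp add: finite_pairings)

lemma configs_iff: "(A, p) \<in> configs \<longleftrightarrow> p \<in> pairings V \<and> A \<in> compat V p"
  by (auto simp: configs_def compat_def)

lemma kraft:
  assumes "inj_on pos V"
  shows "(\<Sum>(A, p)\<in>configs. 1 / (\<Prod>v\<in>V. fact h * balance_prob (free (below pos v) p v)))
    = real (card orients)"
proof -
  \<comment> \<open>This threshold exceeds all positions, so every vertex has been treated;
    inserting 0 keeps \<open>Max\<close> meaningful for empty \<open>V\<close>.\<close>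
  define k where "k = Suc (Max (insert 0 (pos ` V)))"
  have "pos w < k" if "w \<in> V" for w
    using that finite_V by (simp add: k_def less_Suc_eq_le)
  then have V: "{w \<in> V. pos w < k} = V" by auto
  define g :: "('a \<Rightarrow> 'a \<Rightarrow> 'a) \<Rightarrow> real"
    where "g p = 1 / (\<Prod>v\<in>V. fact h * balance_prob (free (below pos v) p v))" for p
  have "configs = prod.swap ` (SIGMA p:pairings V. compat V p)"
    by (auto simp: configs_def compat_def)
  then have "(\<Sum>(A, p)\<in>configs. g p) = (\<Sum>(p, A)\<in>(SIGMA p:pairings V. compat V p). g p)"
    by (simp add: sum.reindex case_prod_beta')
  also have "\<dots> = (\<Sum>p\<in>pairings V. \<Sum>A\<in>compat V p. g p)"
    by (rule sum.Sigma[symmetric]) (auto simp: finite_pairings finite_compat)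
  also have "\<dots> = real (card orients)"
    using kraft_below[OF assms, of k] unfolding V by (simp add: g_def)
  finally show ?thesis by (simp add: g_def)
qed

text \<open>In degree \<open>2 * h\<close>, out-degree \<open>h\<close> expresses balance.\<close>

definition eulers :: "('a \<times> 'a) set set" where
  "eulers = {A \<in> orients. \<forall>v\<in>V. card (outs A v) = h}"

lemma pairings_compat_eq:
  assumes "A \<in> orients"
  shows "{p \<in> pairings V. A \<in> compat V p} = (\<Pi>\<^sub>E v\<in>V. crossing_matchings (N v) (outs A v))"
  using assms by (simp add: set_eq_iff pairings_def compat_def PiE_iff crossing_outs_iff) blast

text \<open>Each balanced vertex offers \<open>fact h\<close> matchings, and a single unbalanced one
  makes the product vanish.\<close>

lemma card_pairings_compat:
  assumes "A \<in> orients"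
  shows "card {p \<in> pairings V. A \<in> compat V p} = (if A \<in> eulers then fact h ^ card V else 0)"
proof -
  have "card {p \<in> pairings V. A \<in> compat V p} = (\<Prod>v\<in>V. if card (outs A v) = h then fact h else 0)"
    unfolding pairings_compat_eq[OF assms] card_PiE[OF finite_V]
    by (rule prod.cong[OF refl]) (rule card_crossing_outs)
  then show ?thesis using assms finite_V by (auto simp: eulers_def)
qed

lemma card_configs: "card configs = card eulers * fact h ^ card V"
proof -
  have "card configs = (\<Sum>A\<in>orients. card {p \<in> pairings V. A \<in> compat V p})"
    unfolding configs_def by (rule card_SigmaI) (auto simp: finite_orients finite_pairings)
  also have "\<dots> = (\<Sum>A\<in>orients. if A \<in> eulers then fact h ^ card V else 0)"
    by (rule sum.cong[OF refl]) (rule card_pairings_compat)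
  also have "\<dots> = card eulers * fact h ^ card V"
  proof -
    have "orients \<inter> {A. A \<in> eulers} = eulers" by (auto simp: eulers_def)
    then show ?thesis by (simp add: sum.If_cases finite_orients)
  qed
  finally show ?thesis .
qed

lemma card_orients: "card orients = 2 ^ (card V * h)"
proof -
  obtain pos :: "'a \<Rightarrow> nat" where pos: "inj_on pos V"
    using finite_imp_inj_to_nat_seg[OF finite_V] by blast
  \<comment> \<open>The numbering selects one dart of each edge, so an orientation amounts to an
    arbitrary subset of \<open>P\<close>.\<close>
  define P where "P = {(v, u). u \<in> N v \<and> pos v < pos u}"
  have asym: "u \<in> N v \<Longrightarrow> (u, v) \<in> P \<longleftrightarrow> (v, u) \<notin> P" for u v
    using pos N_V[of u v] N_irrefl[of v] N_sym[of u v] unfolding P_def inj_on_def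
    by (metis (mono_tags, lifting) case_prod_conv linorder_neqE_nat mem_Collect_eq order_less_asym')
  have PD: "P \<subseteq> darts" by (auto simp: P_def)
  have fP: "finite P" using finite_subset[OF PD finite_darts] .
  have "darts = P \<union> prod.swap ` P"
  proof -
    have "x \<in> P \<union> prod.swap ` P" if "x \<in> darts" for x
      using that asym[of "snd x" "fst x"] by (cases x) force
    moreover have "prod.swap ` P \<subseteq> darts" unfolding P_def by (auto dest: N_sym)
    ultimately show ?thesis using PD by blast
  qed
  moreover have "P \<inter> prod.swap ` P = {}" by (auto simp: P_def)
  ultimately have "card darts = card P + card P"
    using card_Un_disjoint[OF fP, of "prod.swap ` P"] fP by (simp add: card_image)
  then have cP: "card P = card V * h" using card_darts by simp
  have "bij_betw (\<lambda>A. A \<inter> P) orients (Pow P)"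
  proof (rule bij_betw_byWitness[where f' = "\<lambda>B. B \<union> {(u, v). (v, u) \<in> P - B}"])
    show "\<forall>A\<in>orients. A \<inter> P \<union> {(u, v). (v, u) \<in> P - A \<inter> P} = A"
    proof
      fix A assume A: "A \<in> orients"
      have o: "(u, v) \<in> A \<longleftrightarrow> (v, u) \<notin> A" if "u \<in> N v" for u v
        using A that by (auto simp: orients_def)
      have "(a, b) \<in> A \<inter> P \<union> {(u, v). (v, u) \<in> P - A \<inter> P} \<longleftrightarrow> (a, b) \<in> A" for a b
      proof (cases "b \<in> N a")
        case True
        then show ?thesis using o[OF True] asym[OF True] by blast
      next
        case False
        then have "(a, b) \<notin> darts" "(b, a) \<notin> darts" using N_sym[of a b] by auto
        moreover have "A \<subseteq> darts" using A by (simp add: orients_def)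
        ultimately have "(a, b) \<notin> A" "(b, a) \<notin> P" using PD by auto
        then show ?thesis by blast
      qed
      then show "A \<inter> P \<union> {(u, v). (v, u) \<in> P - A \<inter> P} = A" by auto
    qed
    show "\<forall>B\<in>Pow P. (B \<union> {(u, v). (v, u) \<in> P - B}) \<inter> P = B" by (auto simp: P_def)
    show "(\<lambda>B. B \<union> {(u, v). (v, u) \<in> P - B}) ` Pow P \<subseteq> orients"
    proof (rule image_subsetI)
      fix B assume B: "B \<in> Pow P"
      show "B \<union> {(u, v). (v, u) \<in> P - B} \<in> orients"
        unfolding orients_def
      proof (intro CollectI conjI allI impI)
        have "{(u, v). (v, u) \<in> P - B} \<subseteq> darts" unfolding P_def by (auto dest: N_sym)
        then show "B \<union> {(u, v). (v, u) \<in> P - B} \<subseteq> darts" using B PD by auto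
        fix v u assume "u \<in> N v"
        then show "(u, v) \<in> B \<union> {(u, v). (v, u) \<in> P - B} \<longleftrightarrow> (v, u) \<notin> B \<union> {(u, v). (v, u) \<in> P - B}"
          using asym[of u v] B by blast
      qed
    qed
  qed auto
  then show ?thesis using bij_betw_same_card card_Pow[OF fP] cP by metis
qed

end

section \<open>Entropy bounds and random vertex orders\<close>

text \<open>Precomposing with the transposition of \<open>v\<close> and \<open>w\<close> injects the
  orders with \<open>v\<close> last in \<open>W\<close> into those with \<open>w\<close> last, and
  these events are disjoint for different \<open>w\<close>.\<close>

lemma card_permutations_last_le:
  fixes idx :: "'a \<Rightarrow> nat"
  assumes "finite V" "W \<subseteq> V" "v \<in> W"
  shows "card W * card {\<sigma>. \<sigma> permutes V \<and> (\<forall>w\<in>W - {v}. idx (\<sigma> w) < idx (\<sigma> v))}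
    \<le> card {\<sigma>. \<sigma> permutes V}"
proof -
  define E where "E v = {\<sigma>. \<sigma> permutes V \<and> (\<forall>w\<in>W - {v}. idx (\<sigma> w) < idx (\<sigma> v))}" for v
  have fP: "finite {\<sigma>. \<sigma> permutes V}" by (rule finite_permutations[OF assms(1)])
  have fE: "finite (E w)" for w by (rule finite_subset[OF _ fP]) (auto simp: E_def)
  have fW: "finite W" using assms finite_subset by blast
  have le: "card (E v) \<le> card (E w)" if w: "w \<in> W" for w
  proof (rule card_inj_on_le[OF _ _ fE])
    let ?t = "Transposition.transpose v w"
    have t: "?t permutes V" by (rule permutes_swap_id) (use assms w in auto)
    show "inj_on (\<lambda>\<sigma>. \<sigma> \<circ> ?t) (E v)"
    proof (rule inj_onI)
      fix \<sigma> \<tau> :: "'a \<Rightarrow> 'a" assume "\<sigma> \<circ> ?t = \<tau> \<circ> ?t"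
      then have "(\<sigma> \<circ> ?t) (?t x) = (\<tau> \<circ> ?t) (?t x)" for x by simp
      then show "\<sigma> = \<tau>" by (simp add: fun_eq_iff)
    qed
    show "(\<lambda>\<sigma>. \<sigma> \<circ> ?t) ` E v \<subseteq> E w"
    proof (rule image_subsetI)
      fix \<sigma> assume s: "\<sigma> \<in> E v"
      have "?t x \<in> W - {v}" if "x \<in> W - {w}" for x
        using that w assms(3) by (auto simp: Transposition.transpose_def)
      then show "\<sigma> \<circ> ?t \<in> E w"
        using s permutes_compose[OF t, of \<sigma>] by (auto simp: E_def)
    qed
  qed
  have "card W * card (E v) = (\<Sum>w\<in>W. card (E v))" by simp
  also have "\<dots> \<le> (\<Sum>w\<in>W. card (E w))" by (rule sum_mono) (rule le)
  also have "\<dots> = card (\<Union>w\<in>W. E w)"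
  proof (rule card_UN_disjoint[symmetric, OF fW])
    show "\<forall>x\<in>W. \<forall>y\<in>W. x \<noteq> y \<longrightarrow> E x \<inter> E y = {}"
    proof (intro ballI impI equals0I)
      fix x y \<sigma> assume "x \<in> W" "y \<in> W" "x \<noteq> y" "\<sigma> \<in> E x \<inter> E y"
      then have "idx (\<sigma> x) < idx (\<sigma> y)" "idx (\<sigma> y) < idx (\<sigma> x)" by (auto simp: E_def)
      then show False by simp
    qed
  qed (use fE in auto)
  also have "\<dots> \<le> card {\<sigma>. \<sigma> permutes V}" by (rule card_mono[OF fP]) (auto simp: E_def)
  finally show ?thesis by (simp add: E_def)
qed

section \<open>Pauling's lower bound, the entropy bound and returning darts in a random
  order\<close>

context even_graph
begin

text \<open>The parity found here lets the facts on \<open>balance_prob\<close> at even arguments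
  apply.\<close>

lemma free_config:
  assumes "(A, p) \<in> configs" "v \<in> V" "v \<notin> S" "S \<subseteq> V"
  obtains k where "k \<le> h" "free S p v = 2 * k" "card (loops S p v) + 2 * k = 2 * h"
proof -
  \<comment> \<open>Pairings on \<open>S\<close> are extensional, so \<open>p\<close> is restricted;
    walks through \<open>S\<close> are unaffected.\<close>
  define q where "q = restrict p S"
  have q: "q \<in> pairings S" "A \<in> compat S q"
    using assms(1,4) unfolding configs_iff q_def pairings_def compat_def by (auto simp: subset_iff)
  have "free S q = free S p" by (rule free_cong) (simp add: q_def)
  then have 1: "free S p v + 2 * card (loops S q v \<inter> outs A v) = 2 * h"
    using free_eq[OF q assms(3,2)] by simp
  define k where "k = h - card (loops S q v \<inter> outs A v)"
  have k: "free S p v = 2 * k" "k \<le> h" using 1 by (auto simp: k_def)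
  have "card (loops S p v) + free S p v = card (N v)"
    unfolding free_def using card_Diff_subset[OF finite_subset[OF loops_sub finite_N] loops_sub]
      card_mono[OF finite_N loops_sub] by (metis le_add_diff_inverse)
  then show ?thesis using that[of k] k card_N[OF assms(2)] by simp
qed

lemma below_sub: "below pos v \<subseteq> V" "v \<notin> below pos v"
  by (auto simp: below_def)

text \<open>In the identity \<open>kraft\<close> every \<open>balance_prob\<close> factor is
  replaced by its least value, the one at full degree. The powers of \<open>fact h\<close> then
  cancel against those in \<open>card configs\<close>.\<close>

lemma pauling_lower: "real (card orients) * balance_prob (2 * h) ^ card V \<le> real (card eulers)"
proof -
  obtain pos :: "'a \<Rightarrow> nat" where pos: "inj_on pos V"
    using finite_imp_inj_to_nat_seg[OF finite_V] by blast
  define c where "c = fact h * balance_prob (2 * h)"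
  have c: "c > 0" by (simp add: c_def balance_prob_pos)
  have "real (card orients) \<le> (\<Sum>(A, p)\<in>configs. 1 / c ^ card V)"
    unfolding kraft[OF pos, symmetric]
  proof (rule sum_mono, clarify)
    fix A p assume Ap: "(A, p) \<in> configs"
    have "c ^ card V = (\<Prod>v\<in>V. c)" by simp
    also have "\<dots> \<le> (\<Prod>v\<in>V. fact h * balance_prob (free (below pos v) p v))"
    proof (rule prod_mono, intro conjI)
      fix v assume v: "v \<in> V"
      obtain k where "k \<le> h" "free (below pos v) p v = 2 * k"
        using free_config[OF Ap v, of "below pos v"] below_sub by metis
      then show "c \<le> fact h * balance_prob (free (below pos v) p v)"
        using balance_prob_antimono unfolding c_def by (auto intro!: mult_left_mono)
    qed (use c in simp)
    finally show "1 / (\<Prod>v\<in>V. fact h * balance_prob (free (below pos v) p v)) \<le> 1 / c ^ card V"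
      using c by (intro divide_left_mono) (auto intro!: mult_pos_pos prod_pos simp: balance_prob_pos)
  qed
  also have "\<dots> = real (card eulers) * fact h ^ card V / c ^ card V"
    by (simp add: card_configs case_prod_beta')
  also have "\<dots> = real (card eulers) / balance_prob (2 * h) ^ card V"
    by (simp add: c_def power_mult_distrib)
  finally show ?thesis using balance_prob_pos[of "2 * h"] by (simp add: pos_le_divide_eq)
qed

lemma card_eulers_pos: "card eulers > 0"
proof -
  have "real (card orients) * balance_prob (2 * h) ^ card V > 0"
    by (simp add: card_orients balance_prob_pos)
  then show ?thesis using pauling_lower by linarith
qed

lemma card_configs_pos: "card configs > 0"
  using card_eulers_pos by (simp add: card_configs)

text \<open>Jensen's inequality is applied to a uniformly random configuration, whose inverse
  weights sum to \<open>card orients\<close> by \<open>kraft\<close>. The terms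
  \<open>ln (fact h)\<close> cancel, and each returning dart costs at most \<open>ln d / d\<close>
  with \<open>d = 2 * h\<close>.\<close>

lemma entropy_upper:
  assumes pos: "inj_on pos V"
  shows "real (card configs) * ln (real (card eulers)) \<le>
    real (card configs) * (ln (real (card orients)) + real (card V) * ln (balance_prob (2 * h))) +
    ln (real (2 * h)) / real (2 * h) * (\<Sum>(A, p)\<in>configs. \<Sum>v\<in>V. real (card (loops (below pos v) p v)))"
proof -
  define w where "w = (\<lambda>(A :: ('a \<times> 'a) set, p). \<Prod>v\<in>V. fact h * balance_prob (free (below pos v) p v))"
  define b where "b = ln (balance_prob (2 * h))"
  define n where "n = real (card V)"
  define M where "M = real (card configs)"
  have hp: "real h > 0" using h_pos by simp
  have "M * (ln M - ln (\<Sum>x\<in>configs. 1 / w x)) \<le> (\<Sum>x\<in>configs. ln (w x))"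
    unfolding M_def
  proof (rule sum_ln_inverse_le[OF finite_configs])
    show "configs \<noteq> {}" using card_configs_pos by auto
  qed (auto simp: w_def balance_prob_pos intro!: prod_pos)
  moreover have "(\<Sum>x\<in>configs. 1 / w x) = real (card orients)"
    using kraft[OF pos] by (simp add: w_def case_prod_beta')
  moreover have "ln M = ln (real (card eulers)) + n * ln (fact h)"
    using card_eulers_pos by (simp add: M_def card_configs ln_mult ln_realpow n_def)
  moreover have "(\<Sum>x\<in>configs. ln (w x)) \<le> (\<Sum>(A, p)\<in>configs. n * ln (fact h) + n * b +
      ln (real (2 * h)) / real (2 * h) * (\<Sum>v\<in>V. real (card (loops (below pos v) p v))))"
  proof (rule sum_mono, clarify)
    fix A p assume Ap: "(A, p) \<in> configs"
    have "ln (w (A, p)) = (\<Sum>v\<in>V. ln (fact h * balance_prob (free (below pos v) p v)))"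
      unfolding w_def prod.case by (rule ln_prod) (auto simp: finite_V less_imp_neq[OF balance_prob_pos, symmetric])
    also have "\<dots> \<le> (\<Sum>v\<in>V. ln (fact h) + b +
        ln (real (2 * h)) / real (2 * h) * real (card (loops (below pos v) p v)))"
    proof (rule sum_mono)
      fix v assume v: "v \<in> V"
      obtain k where k: "k \<le> h" "free (below pos v) p v = 2 * k"
        "card (loops (below pos v) p v) + 2 * k = 2 * h"
        using free_config[OF Ap v, of "below pos v"] below_sub by metis
      define l where "l = real (card (loops (below pos v) p v))"
      have l: "real k = real h - l / 2" "l \<ge> 0" using k(3) by (auto simp: l_def)
      \<comment> \<open>By convexity the value lies below the chord from 0, where the function
        vanishes, to \<open>h\<close>.\<close>
      have "ln (balance_prob (2 * k)) \<le> real k / real h * b"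
        using ln_balance_prob_convex[OF k(1)] hp by (simp add: b_def field_simps)
      also have "\<dots> = b + l / real (2 * h) * (- b)"
        unfolding l(1) using hp by (simp add: diff_divide_distrib left_diff_distrib)
      also have "\<dots> \<le> b + l / real (2 * h) * ln (real (2 * h))"
        using ln_balance_prob_lower[OF h_pos] l(2)
        by (intro add_left_mono mult_left_mono) (auto simp: b_def)
      finally have "ln (balance_prob (2 * k)) \<le> b + l / real (2 * h) * ln (real (2 * h))" .
      moreover have "ln (fact h * balance_prob (2 * k)) = ln (fact h) + ln (balance_prob (2 * k))"
        by (rule ln_mult_pos) (simp_all add: balance_prob_pos)
      moreover have "ln (real (2 * h)) / real (2 * h) * l = l / real (2 * h) * ln (real (2 * h))"
        by (simp only: times_divide_eq_left mult.commute[of l])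
      ultimately show "ln (fact h * balance_prob (free (below pos v) p v)) \<le> ln (fact h) + b +
        ln (real (2 * h)) / real (2 * h) * real (card (loops (below pos v) p v))"
        unfolding k(2) l_def[symmetric] by linarith
    qed
    also have "\<dots> = n * ln (fact h) + n * b +
      ln (real (2 * h)) / real (2 * h) * (\<Sum>v\<in>V. real (card (loops (below pos v) p v)))"
      by (simp add: sum.distrib n_def sum_distrib_left distrib_left)
    finally show "ln (w (A, p)) \<le> n * ln (fact h) + n * b +
      ln (real (2 * h)) / real (2 * h) * (\<Sum>v\<in>V. real (card (loops (below pos v) p v)))" .
  qed
  moreover have "(\<Sum>(A, p)\<in>configs. n * ln (fact h) + n * b +
      ln (real (2 * h)) / real (2 * h) * (\<Sum>v\<in>V. real (card (loops (below pos v) p v))))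
    = M * (n * ln (fact h) + n * b) + ln (real (2 * h)) / real (2 * h) *
      (\<Sum>(A, p)\<in>configs. \<Sum>v\<in>V. real (card (loops (below pos v) p v)))"
    by (simp add: case_prod_beta' sum.distrib sum_distrib_left M_def distrib_left)
  ultimately show ?thesis
    unfolding M_def[symmetric] n_def[symmetric] b_def[symmetric] by (simp add: algebra_simps)
qed

text \<open>The walk uses the matchings at all of \<open>V\<close>, which makes badness independent
  of the order of the vertices.\<close>

definition bad_darts :: "nat \<Rightarrow> ('a \<Rightarrow> 'a \<Rightarrow> 'a) \<Rightarrow> ('a \<times> 'a) set" where
  "bad_darts L p = {x \<in> darts. \<not> inj_on (\<lambda>j. fst (walk V p x j)) {..L}}"

lemma walk_below:
  assumes "S \<subseteq> V" "exits S p x k" "j \<le> k"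
  shows "walk S p x j = walk V p x j"
  using assms(3)
proof (induction j)
  case (Suc j)
  have "snd (walk S p x j) \<in> S" using Suc.prems assms(2) by (simp add: exits_def)
  then have "step S p (walk S p x j) = step V p (walk S p x j)"
    using assms(1) by (simp add: step_def subset_iff)
  then show ?case using Suc by simp
qed simp

text \<open>A walk with \<open>L + 1\<close> distinct vertices cannot return within \<open>L\<close>
  steps. Apart from the start, these vertices are therefore inner vertices of the returning path,
  and so come earlier.\<close>

lemma good_dart_last:
  assumes x: "x \<in> darts" "x \<notin> bad_darts L p" and l: "snd x \<in> loops (below pos (fst x)) p (fst x)"
    and w: "w \<in> (\<lambda>j. fst (walk V p x j)) ` {..L} - {fst x}"
  shows "pos w < pos (fst x)"
proof -
  define S where "S = below pos (fst x)"
  obtain k where k: "exits S p x k" "snd (walk S p x k) = fst x"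
    using l by (auto simp: loops_def S_def)
  have S: "S \<subseteq> V" by (simp add: S_def below_sub)
  \<comment> \<open>The dart following the return starts at \<open>fst x\<close>, so index
    \<open>Suc k\<close> repeats the vertex of index 0.\<close>
  have "fst (walk V p x (Suc k)) = fst (walk V p x 0)"
    using k(2) walk_below[OF S k(1) le_refl] fst_walk_Suc[of k V p x] by simp
  then have "\<not> Suc k \<le> L"
    using x inj_onD[of "\<lambda>j. fst (walk V p x j)" "{..L}" "Suc k" 0] by (auto simp: bad_darts_def)
  obtain j where j: "j \<le> L" "w = fst (walk V p x j)" using w by auto
  have "j \<noteq> 0" using j w by (cases j) auto
  then obtain i where i: "j = Suc i" using not0_implies_Suc by blast
  have ik: "i < k" using i j \<open>\<not> Suc k \<le> L\<close> by simp
  have "w = snd (walk V p x i)" using j i fst_walk_Suc by metis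
  also have "\<dots> = snd (walk S p x i)" using walk_below[OF S k(1), of i] ik by simp
  also have "\<dots> \<in> S" using k(1) ik by (simp add: exits_def)
  finally show ?thesis by (simp add: S_def below_def)
qed

text \<open>For fixed \<open>p\<close> the sums over orders and darts are exchanged. A bad dart is
  charged for every order, a good one only when its vertex comes last among \<open>L + 1\<close>
  vertices that do not depend on the order.\<close>

lemma sum_loops_permutations:
  fixes idx :: "'a \<Rightarrow> nat"
  assumes p: "p \<in> pairings V"
  shows "(\<Sum>\<sigma>\<in>{\<sigma>. \<sigma> permutes V}. \<Sum>v\<in>V. real (card (loops (below (idx \<circ> \<sigma>) v) p v)))
    \<le> fact (card V) * (real (card (bad_darts L p)) + real (card darts) / real (Suc L))"
proof -
  define P where "P = {\<sigma>. \<sigma> permutes V}"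
  have fP: "finite P" unfolding P_def by (rule finite_permutations[OF finite_V])
  have cP: "card P = fact (card V)" unfolding P_def by (rule card_permutations[OF refl finite_V])
  define R where "R \<sigma> x \<longleftrightarrow> snd x \<in> loops (below (idx \<circ> \<sigma>) (fst x)) p (fst x)" for \<sigma> x
  have "(\<Sum>v\<in>V. card (loops (below (idx \<circ> \<sigma>) v) p v)) = card {x \<in> darts. R \<sigma> x}" for \<sigma>
  proof -
    have "{x \<in> darts. R \<sigma> x} = (SIGMA v:V. loops (below (idx \<circ> \<sigma>) v) p v)"
      using N_V subsetD[OF loops_sub] by (fastforce simp: R_def)
    then show ?thesis
      using card_SigmaI[OF finite_V, of "\<lambda>v. loops (below (idx \<circ> \<sigma>) v) p v"]
        finite_subset[OF loops_sub finite_N] by simp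
  qed
  then have "(\<Sum>\<sigma>\<in>P. \<Sum>v\<in>V. card (loops (below (idx \<circ> \<sigma>) v) p v)) = (\<Sum>\<sigma>\<in>P. card {x \<in> darts. R \<sigma> x})"
    by simp
  also have "\<dots> = (\<Sum>x\<in>darts. card {\<sigma> \<in> P. R \<sigma> x})"
    using sum.swap_restrict[OF fP finite_darts, of "\<lambda>_ _. 1::nat" R] by simp
  finally have "(\<Sum>\<sigma>\<in>P. \<Sum>v\<in>V. real (card (loops (below (idx \<circ> \<sigma>) v) p v)))
      = (\<Sum>x\<in>darts. real (card {\<sigma> \<in> P. R \<sigma> x}))"
    by (metis (mono_tags, lifting) of_nat_sum sum.cong)
  also have "\<dots> \<le> (\<Sum>x\<in>darts. (if x \<in> bad_darts L p then fact (card V) else 0) + fact (card V) / real (Suc L))"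
  proof (rule sum_mono)
    fix x assume x: "x \<in> darts"
    show "real (card {\<sigma> \<in> P. R \<sigma> x})
      \<le> (if x \<in> bad_darts L p then fact (card V) else 0) + fact (card V) / real (Suc L)"
    proof (cases "x \<in> bad_darts L p")
      case True
      have "card {\<sigma> \<in> P. R \<sigma> x} \<le> card P" by (rule card_mono[OF fP]) auto
      then have "real (card {\<sigma> \<in> P. R \<sigma> x}) \<le> fact (card V)" using cP by (metis of_nat_fact of_nat_le_iff)
      moreover have "(0::real) \<le> fact (card V) / real (Suc L)" by simp
      ultimately show ?thesis unfolding if_P[OF True] by linarith
    next
      case False
      define W where "W = (\<lambda>j. fst (walk V p x j)) ` {..L}"
      have "inj_on (\<lambda>j. fst (walk V p x j)) {..L}" using False x by (simp add: bad_darts_def)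
      then have cW: "card W = Suc L" unfolding W_def by (simp add: card_image)
      have "W \<subseteq> V"
      proof -
        have "fst (walk V p x j) \<in> V" for j
          using walk_darts[OF p x, of j] N_V by (cases "walk V p x j") auto
        then show ?thesis by (auto simp: W_def)
      qed
      moreover have xW: "fst x \<in> W" unfolding W_def by (rule image_eqI[of _ _ 0]) auto
      ultimately have 1: "Suc L * card {\<sigma>. \<sigma> permutes V \<and> (\<forall>w\<in>W - {fst x}. idx (\<sigma> w) < idx (\<sigma> (fst x)))} \<le> fact (card V)"
        using card_permutations_last_le[OF finite_V, of W "fst x" idx] cW cP by (simp add: P_def)
      have "card {\<sigma> \<in> P. R \<sigma> x} \<le> card {\<sigma>. \<sigma> permutes V \<and> (\<forall>w\<in>W - {fst x}. idx (\<sigma> w) < idx (\<sigma> (fst x)))}"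
      proof (rule card_mono)
        show "{\<sigma> \<in> P. R \<sigma> x} \<subseteq> {\<sigma>. \<sigma> permutes V \<and> (\<forall>w\<in>W - {fst x}. idx (\<sigma> w) < idx (\<sigma> (fst x)))}"
          using good_dart_last[OF x False] unfolding P_def R_def W_def by fastforce
      qed (rule finite_subset[OF _ fP], auto simp: P_def)
      then have "Suc L * card {\<sigma> \<in> P. R \<sigma> x} \<le> fact (card V)"
        using 1 mult_le_mono2[of _ _ "Suc L"] order_trans by blast
      then have "real (Suc L * card {\<sigma> \<in> P. R \<sigma> x}) \<le> real (fact (card V))" by (rule of_nat_mono)
      then have "real (card {\<sigma> \<in> P. R \<sigma> x}) * real (Suc L) \<le> fact (card V)"
        unfolding of_nat_mult of_nat_fact by (simp only: mult.commute)
      then have "real (card {\<sigma> \<in> P. R \<sigma> x}) \<le> fact (card V) / real (Suc L)"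
        by (rule pos_le_divide_eq[THEN iffD2, rotated]) simp
      then show ?thesis using False by simp
    qed
  qed
  also have "\<dots> = fact (card V) * (real (card (bad_darts L p)) + real (card darts) / real (Suc L))"
  proof -
    have "darts \<inter> {x. x \<in> bad_darts L p} = bad_darts L p" by (auto simp: bad_darts_def)
    then show ?thesis by (simp add: sum.distrib sum.If_cases finite_darts algebra_simps)
  qed
  finally show ?thesis by (simp add: P_def)
qed

end

section \<open>Cycles\<close>

context even_graph
begin

text \<open>Only the vertex must recur after \<open>l\<close> steps, not the dart: the matching at
  the closing vertex is left unconstrained.\<close>

definition cyclic_darts :: "nat \<Rightarrow> ('a \<Rightarrow> 'a \<Rightarrow> 'a) \<Rightarrow> ('a \<times> 'a) set" where
  "cyclic_darts l p =
    {x \<in> darts. fst (walk V p x l) = fst x \<and> inj_on (\<lambda>j. fst (walk V p x j)) {..<l}}"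

text \<open>Length 1 would need a loop of the graph, and length 2 a fixed point of a
  matching.\<close>

lemma cyclic_darts_length:
  assumes p: "p \<in> pairings V" and x: "x \<in> cyclic_darts l p" and l: "l > 0"
  shows "3 \<le> l"
proof -
  obtain v u where vu: "x = (v, u)" by fastforce
  have u: "u \<in> N v" using x vu by (simp add: cyclic_darts_def)
  have "l \<noteq> 1" using x u N_irrefl by (auto simp: cyclic_darts_def vu step_def)
  moreover have "l \<noteq> 2"
  proof
    assume "l = 2"
    then have "p u v = v"
      using x N_V[OF u] by (simp add: cyclic_darts_def vu step_def numeral_2_eq_2)
    then show False using pairingsD(3)[OF p _ N_sym[OF u]] N_V[OF u] by blast
  qed
  ultimately show ?thesis using l by linarith
qed

text \<open>At the first repetition of a vertex, the stretch since its earlier visit is a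
  cycle.\<close>

lemma bad_darts_cyclic:
  assumes p: "p \<in> pairings V" and x: "x \<in> bad_darts L p"
  shows "\<exists>i<L. \<exists>l\<in>{3..L}. walk V p x i \<in> cyclic_darts l p"
proof -
  define t where "t j = fst (walk V p x j)" for j
  have xd: "x \<in> darts" and "\<not> inj_on t {..L}" using x by (simp_all add: bad_darts_def t_def[abs_def])
  then have "\<exists>b. b \<le> L \<and> (\<exists>a<b. t a = t b)"
    unfolding inj_on_def by (metis atMost_iff linorder_neqE_nat)
  then obtain b where b: "b \<le> L \<and> (\<exists>a<b. t a = t b)"
    and least: "\<And>c. c < b \<Longrightarrow> \<not> (c \<le> L \<and> (\<exists>a<c. t a = t c))"
    using exists_least_iff[of "\<lambda>b. b \<le> L \<and> (\<exists>a<b. t a = t b)"] by blast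
  obtain a where a: "a < b" "t a = t b" using b by blast
  define l where "l = b - a"
  have tj: "fst (walk V p (walk V p x a) j) = t (j + a)" for j
    by (simp add: t_def funpow_add)
  have inj: "inj_on (\<lambda>j. t (j + a)) {..<l}"
  proof (rule linorder_inj_onI)
    fix i j assume "i < j" "i \<in> {..<l}" "j \<in> {..<l}"
    then have "j + a < b" "i + a < j + a" by (auto simp: l_def)
    then show "t (i + a) \<noteq> t (j + a)" using least[of "j + a"] b by auto
  qed auto
  have cyc: "walk V p x a \<in> cyclic_darts l p"
    unfolding cyclic_darts_def using walk_darts[OF p xd, of a] inj a tj
    by (simp add: l_def t_def[symmetric])
  moreover have "l > 0" "l \<le> L" "a < L" using a b by (auto simp: l_def)
  moreover from \<open>l > 0\<close> have "3 \<le> l" by (rule cyclic_darts_length[OF p cyc])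
  ultimately show ?thesis by (intro exI[of _ a] conjI bexI[of _ l]) auto
qed

text \<open>A union bound over the time at which the cycle starts and its length. Steps are
  injective, so no more darts reach a cyclic dart after \<open>i\<close> steps than there are cyclic
  darts.\<close>

lemma card_bad_darts_le:
  assumes p: "p \<in> pairings V"
  shows "card (bad_darts L p) \<le> L * (\<Sum>l\<in>{3..L}. card (cyclic_darts l p))"
proof -
  define B where "B i l = {x \<in> darts. walk V p x i \<in> cyclic_darts l p}" for i l
  have fB: "finite (B i l)" for i l by (simp add: B_def finite_darts)
  have fC: "finite (cyclic_darts l p)" for l by (simp add: cyclic_darts_def finite_darts)
  have "card (bad_darts L p) \<le> card (\<Union>i<L. \<Union>l\<in>{3..L}. B i l)"
  proof (rule card_mono)
    show "bad_darts L p \<subseteq> (\<Union>i<L. \<Union>l\<in>{3..L}. B i l)"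
    proof
      fix x assume x: "x \<in> bad_darts L p"
      then have "x \<in> darts" by (simp add: bad_darts_def)
      then show "x \<in> (\<Union>i<L. \<Union>l\<in>{3..L}. B i l)"
        using bad_darts_cyclic[OF p x] by (auto simp: B_def)
    qed
  qed (use fB in auto)
  also have "\<dots> \<le> (\<Sum>i<L. card (\<Union>l\<in>{3..L}. B i l))" by (rule card_UN_le) simp
  also have "\<dots> \<le> (\<Sum>i<L. \<Sum>l\<in>{3..L}. card (B i l))"
    by (rule sum_mono) (rule card_UN_le, simp)
  also have "\<dots> \<le> (\<Sum>i<L. \<Sum>l\<in>{3..L}. card (cyclic_darts l p))"
  proof (intro sum_mono)
    fix i l
    have "inj (step V p ^^ i)" using inj_step[OF p] by (rule inj_fn)
    then show "card (B i l) \<le> card (cyclic_darts l p)"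
      by (intro card_inj_on_le[of "step V p ^^ i", OF _ _ fC]) (auto simp: B_def inj_on_def)
  qed
  also have "\<dots> = L * (\<Sum>l\<in>{3..L}. card (cyclic_darts l p))" by simp
  finally show ?thesis .
qed

text \<open>Cycles come with a starting point and a direction.\<close>

definition cycle_lists :: "nat \<Rightarrow> 'a list set" where
  "cycle_lists l = {vs. length vs = l \<and> distinct vs \<and> (\<forall>j<l. vs ! (Suc j mod l) \<in> N (vs ! j))}"

text \<open>The transition at \<open>vs ! 0\<close> is left out, which leaves one fewer than the
  length.\<close>

definition follows :: "('a \<Rightarrow> 'a \<Rightarrow> 'a) \<Rightarrow> 'a list \<Rightarrow> bool" where
  "follows p vs \<longleftrightarrow>
    (\<forall>j\<in>{1..<length vs}. p (vs ! j) (vs ! (j - 1)) = vs ! (Suc j mod length vs))"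

section \<open>The expected number of traversed cycles\<close>

lemma cycle_lists_sub_V:
  assumes "vs \<in> cycle_lists l" "j < l" shows "vs ! j \<in> V"
proof -
  have "vs ! (Suc j mod l) \<in> N (vs ! j)" using assms by (simp add: cycle_lists_def)
  then show ?thesis using N_V by blast
qed

lemma finite_cycle_lists: "finite (cycle_lists l)"
proof (rule finite_subset[OF _ finite_lists_length_eq[OF finite_V, of l]])
  show "cycle_lists l \<subseteq> {vs. set vs \<subseteq> V \<and> length vs = l}"
  proof clarify
    fix vs assume vs: "vs \<in> cycle_lists l"
    then have "length vs = l" by (simp add: cycle_lists_def)
    then show "set vs \<subseteq> V \<and> length vs = l"
      using cycle_lists_sub_V[OF vs] by (auto simp: in_set_conv_nth)
  qed
qed

text \<open>The first two vertices of a walk determine its dart, so listing its first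
  \<open>l\<close> vertices is injective.\<close>

lemma card_cyclic_darts_le:
  assumes p: "p \<in> pairings V" and l: "l \<ge> 3"
  shows "card (cyclic_darts l p) \<le> card {vs \<in> cycle_lists l. follows p vs}"
proof (rule card_inj_on_le)
  define c where "c x = map (\<lambda>j. fst (walk V p x j)) [0..<l]" for x
  have nth: "c x ! j = fst (walk V p x j)" if "j < l" for x j using that by (simp add: c_def)
  have len: "length (c x) = l" for x by (simp add: c_def)
  show "inj_on c (cyclic_darts l p)"
  proof (rule inj_onI)
    fix x y assume eq: "c x = c y"
    have "fst x = fst y" using nth[of 0 x] nth[of 0 y] eq l by simp
    moreover have "snd x = snd y" using nth[of 1 x] nth[of 1 y] eq l by (simp add: step_def)
    ultimately show "x = y" by (simp add: prod_eq_iff)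
  qed
  show "c ` cyclic_darts l p \<subseteq> {vs \<in> cycle_lists l. follows p vs}"
  proof (rule image_subsetI)
    fix x assume x: "x \<in> cyclic_darts l p"
    then have xd: "x \<in> darts" and cl: "fst (walk V p x l) = fst x"
      and inj: "inj_on (\<lambda>j. fst (walk V p x j)) {..<l}" by (auto simp: cyclic_darts_def)
    have succ: "c x ! (Suc j mod l) = snd (walk V p x j)" if "j < l" for j
    proof (cases "Suc j = l")
      case True
      then show ?thesis using nth[of 0 x] cl fst_walk_Suc[of j V p x] l by simp
    next
      case False
      then show ?thesis using nth[of "Suc j" x] fst_walk_Suc[of j V p x] that by simp
    qed
    have "distinct (c x)"
      unfolding c_def distinct_map using inj by (simp add: atLeast0LessThan)
    moreover have "c x ! (Suc j mod l) \<in> N (c x ! j)" if "j < l" for j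
      using succ[OF that] nth[OF that, of x] walk_darts[OF p xd, of j]
      by (cases "walk V p x j") simp
    moreover have "p (c x ! j) (c x ! (j - 1)) = c x ! (Suc j mod l)" if j: "j \<in> {1..<l}" for j
    proof -
      obtain i where i: "j = Suc i" using j by (cases j) auto
      have V: "snd (walk V p x i) \<in> V"
        using walk_darts[OF p xd, of i] N_V by (cases "walk V p x i") auto
      have "snd (walk V p x j) = p (snd (walk V p x i)) (fst (walk V p x i))"
        using V by (simp add: i step_def)
      moreover have "snd (walk V p x i) = c x ! j" using nth[of j x] j i fst_walk_Suc[of i V p x] by simp
      moreover have "fst (walk V p x i) = c x ! (j - 1)" using nth[of i x] j i by simp
      ultimately show ?thesis using succ[of j] j by simp
    qed
    ultimately show "c x \<in> {vs \<in> cycle_lists l. follows p vs}"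
      by (simp add: cycle_lists_def follows_def len)
  qed
  show "finite {vs \<in> cycle_lists l. follows p vs}" using finite_cycle_lists by simp
qed

text \<open>For a fixed Eulerian orientation, the pairings at the vertices are independent, and each
  transition has probability \<open>1 / h\<close> or \<open>0\<close>.\<close>

lemma card_follows_le:
  assumes A: "A \<in> orients" and vs: "vs \<in> cycle_lists l" and l: "l > 0"
  shows "h ^ (l - 1) * card {p \<in> pairings V. A \<in> compat V p \<and> follows p vs}
    \<le> card {p \<in> pairings V. A \<in> compat V p}"
proof (cases "A \<in> eulers")
  case False
  then have "card {p \<in> pairings V. A \<in> compat V p} = 0" using card_pairings_compat[OF A] by simp
  then have "{p \<in> pairings V. A \<in> compat V p} = {}" using finite_pairings by simp
  then have *: "{p \<in> pairings V. A \<in> compat V p \<and> follows p vs} = {}" by blast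
  show ?thesis unfolding * by simp
next
  case True
  have len: "length vs = l" and dist: "distinct vs" using vs by (auto simp: cycle_lists_def)
  define T where "T = (!) vs ` {1..<l}"
  have inj: "inj_on ((!) vs) {..<l}" using inj_on_nth[OF dist, of "{..<l}"] len by simp
  \<comment> \<open>\<open>ix\<close> gives the position on the cycle, so \<open>a w\<close> and
    \<open>b w\<close> below are the predecessor and the successor of \<open>w\<close>.\<close>
  define ix where "ix = inv_into {..<l} ((!) vs)"
  have ix: "ix (vs ! j) = j" if "j < l" for j unfolding ix_def using inv_into_f_f[OF inj] that by simp
  define a where "a w = vs ! (ix w - 1)" for w
  define b where "b w = vs ! (Suc (ix w) mod l)" for w
  define F where "F w = crossing_matchings (N w) (outs A w)" for w
  have TV: "T \<subseteq> V" using cycle_lists_sub_V[OF vs] by (auto simp: T_def)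
  have "inj_on ((!) vs) {1..<l}" by (rule inj_on_subset[OF inj]) auto
  then have cT: "card T = l - 1" by (simp add: T_def card_image)
  have outs: "card (outs A w) = h" if "w \<in> V" for w using True that by (simp add: eulers_def)
  have "{p \<in> pairings V. A \<in> compat V p \<and> follows p vs}
      \<subseteq> (\<Pi>\<^sub>E w\<in>V. if w \<in> T then {f \<in> F w. f (a w) = b w} else F w)"
  proof
    fix p assume p: "p \<in> {p \<in> pairings V. A \<in> compat V p \<and> follows p vs}"
    then have "p \<in> (\<Pi>\<^sub>E w\<in>V. F w)" using pairings_compat_eq[OF A] by (auto simp: F_def)
    moreover have "p w (a w) = b w" if w: "w \<in> T" for w
    proof -
      obtain j where j: "j \<in> {1..<l}" "w = vs ! j" using w by (auto simp: T_def)
      then have "ix w = j" using ix by simp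
      then show ?thesis using p j by (simp add: follows_def len a_def b_def)
    qed
    ultimately show "p \<in> (\<Pi>\<^sub>E w\<in>V. if w \<in> T then {f \<in> F w. f (a w) = b w} else F w)"
      by (auto simp: PiE_iff)
  qed
  moreover have "finite (\<Pi>\<^sub>E w\<in>V. if w \<in> T then {f \<in> F w. f (a w) = b w} else F w)"
    by (intro finite_PiE finite_V) (auto simp: F_def finite_crossing_matchings finite_N)
  ultimately have "card {p \<in> pairings V. A \<in> compat V p \<and> follows p vs}
      \<le> card (\<Pi>\<^sub>E w\<in>V. if w \<in> T then {f \<in> F w. f (a w) = b w} else F w)"
    by (rule card_mono[rotated])
  also have "\<dots> = (\<Prod>w\<in>V. card (if w \<in> T then {f \<in> F w. f (a w) = b w} else F w))"
    by (rule card_PiE[OF finite_V])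
  \<comment> \<open>The power of \<open>h\<close> is spread as one factor for each of the
    \<open>l - 1\<close> vertices in \<open>T\<close>.\<close>
  finally have "h ^ (l - 1) * card {p \<in> pairings V. A \<in> compat V p \<and> follows p vs}
      \<le> (\<Prod>w\<in>V. if w \<in> T then h else 1) * (\<Prod>w\<in>V. card (if w \<in> T then {f \<in> F w. f (a w) = b w} else F w))"
    using cT TV finite_V by (simp add: prod.If_cases Int_absorb1 Int_absorb2)
  also have "\<dots> = (\<Prod>w\<in>V. (if w \<in> T then h else 1) * card (if w \<in> T then {f \<in> F w. f (a w) = b w} else F w))"
    by (rule prod.distrib[symmetric])
  also have "\<dots> \<le> (\<Prod>w\<in>V. fact h)"
  proof (rule prod_mono, intro conjI)
    fix w assume w: "w \<in> V"
    show "(if w \<in> T then h else 1) * card (if w \<in> T then {f \<in> F w. f (a w) = b w} else F w) \<le> fact h"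
    proof (cases "w \<in> T")
      case T: True
      then obtain j where j: "j \<in> {1..<l}" "w = vs ! j" by (auto simp: T_def)
      have "a w = vs ! (j - 1)" using ix[of j] j by (simp add: a_def)
      moreover have "vs ! (Suc (j - 1) mod l) \<in> N (vs ! (j - 1))"
        using vs less_imp_diff_less[of j l 1] j unfolding cycle_lists_def mem_Collect_eq atLeastLessThan_iff by blast
      ultimately have "w \<in> N (a w)" using j by simp
      then have "a w \<in> N w" by (rule N_sym)
      then have "h * card {f \<in> F w. f (a w) = b w} \<le> fact h"
        unfolding F_def by (intro crossing_matchings_prescribed finite_N outs_sub outs w card_N)
      then show ?thesis using T by simp
    next
      case False
      then show ?thesis using card_crossing_outs[OF w, of A] outs[OF w] by (simp add: F_def)
    qed
  qed simp
  also have "\<dots> = card {p \<in> pairings V. A \<in> compat V p}"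
    using card_pairings_compat[OF A] True by simp
  finally show ?thesis .
qed

lemma card_configs_follows_le:
  assumes vs: "vs \<in> cycle_lists l" and l: "l > 0"
  shows "h ^ (l - 1) * card {x \<in> configs. follows (snd x) vs} \<le> card configs"
proof -
  have *: "{x \<in> configs. follows (snd x) vs}
      = (SIGMA A:orients. {p \<in> pairings V. A \<in> compat V p \<and> follows p vs})"
    by (auto simp: configs_def)
  have "card {x \<in> configs. follows (snd x) vs}
      = (\<Sum>A\<in>orients. card {p \<in> pairings V. A \<in> compat V p \<and> follows p vs})"
    unfolding * by (rule card_SigmaI[OF finite_orients]) (simp add: finite_pairings)
  then have "h ^ (l - 1) * card {x \<in> configs. follows (snd x) vs}
      = (\<Sum>A\<in>orients. h ^ (l - 1) * card {p \<in> pairings V. A \<in> compat V p \<and> follows p vs})"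
    by (simp add: sum_distrib_left)
  also have "\<dots> \<le> (\<Sum>A\<in>orients. card {p \<in> pairings V. A \<in> compat V p})"
    by (rule sum_mono) (rule card_follows_le[OF _ vs l])
  also have "\<dots> = card configs"
    unfolding configs_def
    by (rule card_SigmaI[OF finite_orients, symmetric]) (simp add: finite_pairings)
  finally show ?thesis .
qed

text \<open>Sums over configurations and cycles are exchanged; a given cycle is followed with
  probability at most \<open>1 / h ^ (l - 1)\<close>.\<close>

lemma sum_bad_darts_le:
  "(\<Sum>x\<in>configs. real (card (bad_darts L (snd x)))) \<le>
    real (card configs) * (real L * (\<Sum>l\<in>{3..L}. real (card (cycle_lists l)) / real h ^ (l - 1)))"
proof -
  have 1: "(\<Sum>x\<in>configs. real (card (cyclic_darts l (snd x))))
      \<le> real (card configs) * (real (card (cycle_lists l)) / real h ^ (l - 1))" if l: "l \<ge> 3" for l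
  proof -
    have "(\<Sum>x\<in>configs. card (cyclic_darts l (snd x)))
        \<le> (\<Sum>x\<in>configs. card {vs \<in> cycle_lists l. follows (snd x) vs})"
      by (rule sum_mono) (use card_cyclic_darts_le[OF _ l] configs_iff in force)
    also have "\<dots> = (\<Sum>vs\<in>cycle_lists l. card {x \<in> configs. follows (snd x) vs})"
      using sum.swap_restrict[OF finite_configs finite_cycle_lists[of l], of "\<lambda>_ _. 1::nat"
        "\<lambda>x. follows (snd x)"] by simp
    finally have "(\<Sum>x\<in>configs. real (card (cyclic_darts l (snd x))))
        \<le> (\<Sum>vs\<in>cycle_lists l. real (card {x \<in> configs. follows (snd x) vs}))"
      unfolding of_nat_sum[symmetric] of_nat_le_iff .
    also have "\<dots> \<le> (\<Sum>vs\<in>cycle_lists l. real (card configs) / real h ^ (l - 1))"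
    proof (rule sum_mono)
      fix vs assume "vs \<in> cycle_lists l"
      then have "h ^ (l - 1) * card {x \<in> configs. follows (snd x) vs} \<le> card configs"
        using card_configs_follows_le l by simp
      then have "real (h ^ (l - 1) * card {x \<in> configs. follows (snd x) vs}) \<le> real (card configs)"
        by (rule of_nat_mono)
      then show "real (card {x \<in> configs. follows (snd x) vs}) \<le> real (card configs) / real h ^ (l - 1)"
        using h_pos by (simp add: pos_le_divide_eq mult.commute)
    qed
    finally show ?thesis by (simp add: mult.commute)
  qed
  have "(\<Sum>x\<in>configs. real (card (bad_darts L (snd x))))
      \<le> (\<Sum>x\<in>configs. real L * (\<Sum>l\<in>{3..L}. real (card (cyclic_darts l (snd x)))))"
  proof (rule sum_mono)
    fix x assume "x \<in> configs"
    then have "snd x \<in> pairings V" using configs_iff[of "fst x" "snd x"] by simp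
    then have "real (card (bad_darts L (snd x))) \<le> real (L * (\<Sum>l\<in>{3..L}. card (cyclic_darts l (snd x))))"
      using card_bad_darts_le of_nat_le_iff by blast
    then show "real (card (bad_darts L (snd x))) \<le> real L * (\<Sum>l\<in>{3..L}. real (card (cyclic_darts l (snd x))))"
      by simp
  qed
  also have "\<dots> = real L * (\<Sum>l\<in>{3..L}. \<Sum>x\<in>configs. real (card (cyclic_darts l (snd x))))"
    unfolding sum_distrib_left[symmetric] by (subst sum.swap) simp
  also have "\<dots> \<le> real L * (\<Sum>l\<in>{3..L}. real (card configs) * (real (card (cycle_lists l)) / real h ^ (l - 1)))"
    by (intro mult_left_mono sum_mono 1) auto
  finally show ?thesis
    unfolding sum_distrib_left[symmetric] by (simp only: mult.left_commute)
qed

text \<open>Averaging \<open>entropy_upper\<close> over a uniformly random order of the vertices.\<close>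

lemma ln_eulers_upper:
  "ln (real (card eulers)) \<le> ln (real (card orients)) + real (card V) * ln (balance_prob (2 * h)) +
    ln (real (2 * h)) / real (2 * h) *
      (real L * (\<Sum>l\<in>{3..L}. real (card (cycle_lists l)) / real h ^ (l - 1))
        + real (card darts) / real (Suc L))"
proof -
  obtain idx :: "'a \<Rightarrow> nat" where idx: "inj_on idx V"
    using finite_imp_inj_to_nat_seg[OF finite_V] by blast
  define P where "P = {\<sigma>. \<sigma> permutes V}"
  have cP: "real (card P) = fact (card V)"
    unfolding P_def using card_permutations[OF refl finite_V] by simp
  define M where "M = real (card configs)"
  define E where "E = ln (real (card eulers))"
  define D where "D = ln (real (card orients)) + real (card V) * ln (balance_prob (2 * h))"
  define g where "g = ln (real (2 * h)) / real (2 * h)"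
  define c where "c = real (card darts) / real (Suc L)"
  define s where "s = real L * (\<Sum>l\<in>{3..L}. real (card (cycle_lists l)) / real h ^ (l - 1))"
  have M: "M > 0" using card_configs_pos by (simp add: M_def)
  have g: "g \<ge> 0" using h_pos by (simp add: g_def)
  have F: "(fact (card V) :: real) > 0" by simp
  have "fact (card V) * (M * E) = (\<Sum>\<sigma>\<in>P. M * E)" by (simp add: cP)
  also have "\<dots> \<le> (\<Sum>\<sigma>\<in>P. M * D + g * (\<Sum>(A, p)\<in>configs. \<Sum>v\<in>V. real (card (loops (below (idx \<circ> \<sigma>) v) p v))))"
  proof (rule sum_mono)
    fix \<sigma> assume "\<sigma> \<in> P"
    then have "\<sigma> permutes V" by (simp add: P_def)
    then have "inj_on (idx \<circ> \<sigma>) V"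
      using idx by (simp add: comp_inj_on permutes_image permutes_inj_on)
    then show "M * E \<le> M * D + g * (\<Sum>(A, p)\<in>configs. \<Sum>v\<in>V. real (card (loops (below (idx \<circ> \<sigma>) v) p v)))"
      unfolding M_def E_def D_def g_def by (rule entropy_upper)
  qed
  also have "\<dots> = fact (card V) * (M * D) + g * (\<Sum>(A, p)\<in>configs. \<Sum>\<sigma>\<in>P. \<Sum>v\<in>V. real (card (loops (below (idx \<circ> \<sigma>) v) p v)))"
    unfolding sum.distrib sum_distrib_left[symmetric] case_prod_beta' by (subst sum.swap) (simp add: cP)
  \<comment> \<open>With the sums exchanged, the configuration is fixed while the order varies, as
    \<open>sum_loops_permutations\<close> requires.\<close>
  also have "\<dots> \<le> fact (card V) * (M * D) + g * (\<Sum>x\<in>configs. fact (card V) * (real (card (bad_darts L (snd x))) + c))"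
  proof (intro add_left_mono mult_left_mono[OF _ g] sum_mono)
    fix x assume "x \<in> configs"
    then have "snd x \<in> pairings V" using configs_iff[of "fst x" "snd x"] by simp
    then show "(case x of (A, p) \<Rightarrow> \<Sum>\<sigma>\<in>P. \<Sum>v\<in>V. real (card (loops (below (idx \<circ> \<sigma>) v) p v)))
        \<le> fact (card V) * (real (card (bad_darts L (snd x))) + c)"
      unfolding P_def c_def case_prod_beta' by (rule sum_loops_permutations)
  qed
  also have "\<dots> = fact (card V) * (M * D + g * ((\<Sum>x\<in>configs. real (card (bad_darts L (snd x)))) + M * c))"
    unfolding sum_distrib_left[symmetric] sum.distrib by (simp add: M_def algebra_simps)
  also have "\<dots> \<le> fact (card V) * (M * D + g * (M * s + M * c))"
    using sum_bad_darts_le[of L] g unfolding M_def s_def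
    by (intro mult_left_mono add_left_mono add_right_mono) auto
  finally have "M * E \<le> M * D + g * (M * s + M * c)" using F by (simp only: mult_le_cancel_left_pos)
  also have "\<dots> = M * (D + g * (s + c))" by (simp add: algebra_simps)
  finally have "E \<le> D + g * (s + c)" using M by (simp only: mult_le_cancel_left_pos)
  then show ?thesis by (simp only: E_def D_def g_def s_def c_def)
qed

end

section \<open>Regular graphs\<close>

abbreviation nbrs :: "'a ugraph \<Rightarrow> 'a \<Rightarrow> 'a set" where
  "nbrs G v \<equiv> {u. {v, u} \<in> edges G}"

lemma even_graph_nbrs:
  assumes G: "simple_graph G" and reg: "regular_graph (2 * h) G" and h: "h > 0"
  shows "even_graph (verts G) (nbrs G) h"
proof
  have E: "e \<subseteq> verts G" "card e = 2" if "e \<in> edges G" for e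
    using G that by (auto simp: simple_graph_def)
  show "finite (verts G)" using G by (simp add: simple_graph_def)
  show "v \<notin> verts G \<Longrightarrow> nbrs G v = {}" for v using E(1) by auto
  show "u \<in> nbrs G v \<Longrightarrow> v \<in> nbrs G u" for u v by (simp add: insert_commute)
  show "v \<notin> nbrs G v" for v using E(2)[of "{v}"] by auto
  show "h > 0" by (rule h)
  fix v assume v: "v \<in> verts G"
  have "bij_betw (\<lambda>u. {v, u}) (nbrs G v) {e \<in> edges G. v \<in> e}"
    unfolding bij_betw_def
  proof (intro conjI equalityI subsetI)
    show "inj_on (\<lambda>u. {v, u}) (nbrs G v)" by (auto simp: inj_on_def doubleton_eq_iff)
    fix e assume e: "e \<in> {e \<in> edges G. v \<in> e}"
    then obtain x y where xy: "e = {x, y}" using E(2)[of e] card_2_iff[of e] by auto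
    have "\<exists>u. e = {v, u}" using e xy by auto
    then show "e \<in> (\<lambda>u. {v, u}) ` nbrs G v" using e by auto
  qed auto
  then show "card (nbrs G v) = 2 * h"
    using reg v bij_betw_same_card by (fastforce simp: regular_graph_def)
qed

lemma EO_eq_card_eulers:
  assumes "even_graph (verts G) (nbrs G) h"
  shows "EO G = card (even_graph.eulers (verts G) (nbrs G) h)"
proof -
  interpret even_graph "verts G" "nbrs G" h by (rule assms)
  have ori: "orientation G A \<longleftrightarrow> A \<in> orients" for A
    unfolding orientation_def orients_def darts_def mem_Collect_eq
    by (intro conj_cong) (auto simp: subset_iff insert_commute)
  have "card {u. (u, v) \<in> A} = card {u. (v, u) \<in> A} \<longleftrightarrow> card (outs A v) = h"
    if A: "A \<in> orients" and v: "v \<in> verts G" for A v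
  proof -
    have D: "A \<subseteq> darts" and o: "\<And>u. u \<in> nbrs G v \<Longrightarrow> (u, v) \<in> A \<longleftrightarrow> (v, u) \<notin> A"
      using A unfolding orients_def by blast+
    have 1: "{u. (v, u) \<in> A} = outs A v" using D by (auto simp: outs_def)
    have "u \<in> nbrs G v" if "(u, v) \<in> A" for u using D that N_sym[of v u] by auto
    \<comment> \<open>In-neighbours are the complement of the out-neighbours, so equality of the two
      degrees forces \<open>h\<close>.\<close>
    then have 2: "{u. (u, v) \<in> A} = nbrs G v - outs A v" using o by (auto simp: outs_def)
    have "card (outs A v) \<le> 2 * h" using card_mono[OF finite_N outs_sub] card_N[OF v] by metis
    then show ?thesis
      unfolding 1 2 using card_Diff_subset[of "outs A v" "nbrs G v"] finite_outs outs_sub card_N[OF v] by auto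
  qed
  then have "{A. eulerian_orientation G A} = eulers"
    by (auto simp: eulerian_orientation_def eulers_def ori)
  then show ?thesis by (simp add: EO_def)
qed

text \<open>Two equal edges at different positions would make each position the successor of the
  other modulo \<open>l\<close>, which is impossible for \<open>l \<ge> 3\<close>.\<close>

lemma cycle_lists_closed_trail:
  assumes "even_graph (verts G) (nbrs G) h" and l: "l \<ge> 3"
    and vs: "vs \<in> even_graph.cycle_lists (nbrs G) l"
  shows "closed_trail G vs"
proof -
  interpret even_graph "verts G" "nbrs G" h by (rule assms)
  have len: "length vs = l" and dist: "distinct vs"
    and adj: "\<And>j. j < l \<Longrightarrow> {vs ! j, vs ! (Suc j mod l)} \<in> edges G"
    using vs by (auto simp: cycle_lists_def)
  have lw: "length (walk_edges vs) = l" by (simp add: walk_edges_def len)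
  have nth: "walk_edges vs ! j = {vs ! j, vs ! (Suc j mod l)}" if "j < l" for j
    using that by (simp add: walk_edges_def len nth_rotate1)
  have "distinct (walk_edges vs)"
    unfolding distinct_conv_nth lw
  proof (intro allI impI)
    fix i j assume ij: "i < l" "j < l" "i \<noteq> j"
    have m: "Suc k mod l < l" for k using l by simp
    show "walk_edges vs ! i \<noteq> walk_edges vs ! j"
    proof
      assume "walk_edges vs ! i = walk_edges vs ! j"
      then have "{vs ! i, vs ! (Suc i mod l)} = {vs ! j, vs ! (Suc j mod l)}" using nth ij by simp
      moreover have "vs ! i \<noteq> vs ! j" using dist ij len by (simp add: nth_eq_iff_index_eq)
      ultimately have "vs ! i = vs ! (Suc j mod l)" "vs ! j = vs ! (Suc i mod l)"
        by (auto simp: doubleton_eq_iff)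
      then have "i = Suc j mod l" "j = Suc i mod l"
        using dist ij len m by (simp_all add: nth_eq_iff_index_eq)
      moreover have "Suc k mod l = (if Suc k = l then 0 else Suc k)" if "k < l" for k
        using that by auto
      ultimately show False using ij l by (auto split: if_splits)
    qed
  qed
  moreover have "set (walk_edges vs) \<subseteq> edges G"
    using lw nth adj by (auto simp: in_set_conv_nth)
  moreover have "vs \<noteq> []" using len l by auto
  ultimately show ?thesis by (simp add: closed_trail_def)
qed

text \<open>A class consists of the rotations of one list and of its reversal.\<close>

lemma card_same_trail_class: "card (same_trail `` {vs}) \<le> 2 * length vs"
  "finite (same_trail `` {vs})" if "vs \<noteq> []"
proof -
  let ?R = "\<lambda>ws. (\<lambda>k. rotate k ws) ` {..<length vs}"
  have "rotate k ws \<in> ?R ws" if "length ws = length vs" for k and ws :: "'a list"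
    using rotate_conv_mod[of k ws] that \<open>vs \<noteq> []\<close> by auto
  then have sub: "same_trail `` {vs} \<subseteq> ?R vs \<union> ?R (rev vs)" by (auto simp: same_trail_def)
  have "card (same_trail `` {vs}) \<le> card (?R vs \<union> ?R (rev vs))" by (rule card_mono[OF _ sub]) simp
  also have "\<dots> \<le> card (?R vs) + card (?R (rev vs))" by (rule card_Un_le)
  also have "\<dots> \<le> length vs + length vs"
    by (intro add_mono order_trans[OF card_image_le]) simp_all
  finally show "card (same_trail `` {vs}) \<le> 2 * length vs" by simp
  show "finite (same_trail `` {vs})" by (rule finite_subset[OF sub]) simp
qed

lemma finite_closed_trails:
  assumes "simple_graph G"
  shows "finite {vs. closed_trail G vs \<and> length vs = l}"
proof (rule finite_subset[OF _ finite_lists_length_eq[of "verts G" l]])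
  have "x \<in> verts G" if tr: "closed_trail G vs" and x: "x \<in> set vs" for vs x
  proof -
    obtain j where j: "j < length vs" "x = vs ! j" using x by (auto simp: in_set_conv_nth)
    have lw: "length (walk_edges vs) = length vs" by (simp add: walk_edges_def)
    have "x \<in> walk_edges vs ! j" using j by (simp add: walk_edges_def)
    moreover have "walk_edges vs ! j \<in> edges G"
      using tr j lw nth_mem[of j "walk_edges vs"] by (auto simp: closed_trail_def)
    ultimately show "x \<in> verts G" using assms by (auto simp: simple_graph_def)
  qed
  then show "{vs. closed_trail G vs \<and> length vs = l} \<subseteq> {vs. set vs \<subseteq> verts G \<and> length vs = l}"
    by blast
qed (use assms in \<open>simp add: simple_graph_def\<close>)

text \<open>The classes cover all trails, and each has at most \<open>2 * l\<close> members.\<close>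

lemma card_closed_trails_le:
  assumes "simple_graph G"
  shows "card {vs. closed_trail G vs \<and> length vs = l} \<le> 2 * l * closed_trail_count l G"
proof -
  define T where "T = {vs. closed_trail G vs \<and> length vs = l}"
  have fT: "finite T" unfolding T_def by (rule finite_closed_trails[OF assms])
  have cls: "finite c \<and> card c \<le> 2 * l" if c: "c \<in> T // same_trail" for c
  proof -
    obtain vs where "vs \<in> T" "c = same_trail `` {vs}" using c by (auto simp: quotient_def)
    then show ?thesis using card_same_trail_class[of vs] by (auto simp: T_def closed_trail_def)
  qed
  have fQ: "finite (T // same_trail)" using fT by (simp add: quotient_def)
  have "T \<subseteq> \<Union> (T // same_trail)"
  proof
    fix vs assume vs: "vs \<in> T"
    have "(vs, vs) \<in> same_trail" by (auto simp: same_trail_def intro: exI[of _ 0])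
    then show "vs \<in> \<Union> (T // same_trail)" using vs by (auto simp: quotient_def)
  qed
  then have "card T \<le> card (\<Union> (T // same_trail))" using fQ cls by (intro card_mono) auto
  also have "\<dots> \<le> (\<Sum>c\<in>T // same_trail. card c)" by (rule card_Union_le_sum_card)
  also have "\<dots> \<le> (\<Sum>c\<in>T // same_trail. 2 * l)" by (rule sum_mono) (use cls in blast)
  also have "\<dots> = 2 * l * closed_trail_count l G" by (simp add: closed_trail_count_def T_def)
  finally show ?thesis by (simp add: T_def)
qed

lemma card_cycle_lists_le:
  assumes "simple_graph G" "even_graph (verts G) (nbrs G) h" "l \<ge> 3"
  shows "card (even_graph.cycle_lists (nbrs G) l) \<le> 2 * l * closed_trail_count l G"
proof -
  interpret even_graph "verts G" "nbrs G" h by (rule assms)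
  have "card (cycle_lists l) \<le> card {vs. closed_trail G vs \<and> length vs = l}"
    by (rule card_mono[OF finite_closed_trails[OF assms(1)]])
      (use cycle_lists_closed_trail[OF assms(2,3)] in \<open>auto simp: cycle_lists_def\<close>)
  then show ?thesis using card_closed_trails_le[OF assms(1), of l] by linarith
qed

section \<open>Explicit bounds for the entropy and the limit\<close>

lemma pauling_estimate_eq:
  "pauling_estimate (2 * h) = real h * ln 2 + ln (balance_prob (2 * h))"
proof -
  have "(2::real) ^ (2 * h) > 0" "real (2 * h choose h) > 0" by simp_all
  then have "ln (balance_prob (2 * h)) = ln (real (2 * h choose h)) - ln (2 ^ (2 * h))"
    by (simp add: balance_prob_def ln_div)
  also have "ln (2 ^ (2 * h)) = 2 * real h * ln (2::real)" by (simp add: ln_realpow)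
  finally show ?thesis by (simp add: pauling_estimate_def)
qed

text \<open>The cube of \<open>L\<close> collects one factor for the time at which a cycle starts,
  one for the number of lengths and one for the \<open>2 * l\<close> lists per closed trail. The
  term \<open>1 / Suc L\<close> comes from the good darts.\<close>

lemma residual_entropy_bounds:
  assumes G: "simple_graph G" and reg: "regular_graph d G" and ev: "even d" and d: "d > 0"
    and n: "card (verts G) = n" "n > 0" and C: "C > 0"
    and trails: "\<And>l. 3 \<le> l \<Longrightarrow> l \<le> L \<Longrightarrow>
      real (closed_trail_count l G) \<le> C * exp (- (real l + 1)) * real d ^ (l - 1) * real n"
  shows "0 \<le> residual_entropy G - pauling_estimate d"
    "residual_entropy G - pauling_estimate d
      \<le> ln (real d) * (2 * C * real L ^ 3 / real d + 1 / real (Suc L))"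
proof -
  obtain h where h: "d = 2 * h" using ev by blast
  have eg: "even_graph (verts G) (nbrs G) h"
    using even_graph_nbrs[OF G] reg d h by simp
  interpret even_graph "verts G" "nbrs G" h by (rule eg)
  define \<beta> where "\<beta> = balance_prob (2 * h)"
  have \<beta>: "\<beta> > 0" by (simp add: \<beta>_def balance_prob_pos)
  have EO: "EO G = card eulers" by (rule EO_eq_card_eulers[OF eg])
  have np: "real n > 0" using n by simp
  have lnO: "ln (real (card orients)) + real n * ln \<beta> = real n * pauling_estimate d"
    unfolding h pauling_estimate_eq \<beta>_def card_orients n(1) by (simp add: ln_realpow distrib_left)
  have "ln (real (card orients) * \<beta> ^ n) \<le> ln (real (card eulers))"
    using pauling_lower card_eulers_pos \<beta> by (subst ln_le_cancel_iff) (simp_all add: \<beta>_def n(1) card_orients)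
  moreover have "ln (real (card orients) * \<beta> ^ n) = ln (real (card orients)) + real n * ln \<beta>"
    using \<beta> by (simp add: ln_mult ln_realpow card_orients)
  ultimately have "real n * pauling_estimate d \<le> ln (real (EO G))" using lnO EO by simp
  then show "0 \<le> residual_entropy G - pauling_estimate d"
    using np by (simp add: residual_entropy_def n(1) pos_le_divide_eq mult.commute)
  have cyc: "real (card (cycle_lists l)) / real h ^ (l - 1) \<le> 2 * C * real L * real n"
    if l: "l \<in> {3..L}" for l
  proof -
    \<comment> \<open>Passing from \<open>d ^ (l - 1)\<close> to \<open>h ^ (l - 1)\<close> costs
      \<open>2 ^ (l - 1)\<close>, which the factor \<open>exp (- (real l + 1))\<close>
      absorbs.\<close>
    have "(2::real) ^ (l - 1) \<le> exp 1 ^ (l - 1)"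
      using exp_ge_add_one_self[of 1] by (intro power_mono) auto
    also have "\<dots> = exp (real (l - 1))" by (simp add: exp_of_nat_mult[symmetric])
    also have "\<dots> \<le> exp (real l + 1)" by simp
    finally have "exp (- (real l + 1)) * 2 ^ (l - 1) \<le> exp (- (real l + 1)) * exp (real l + 1)"
      by (intro mult_left_mono) auto
    also have "\<dots> = 1" by (simp add: mult_exp_exp)
    finally have e: "exp (- (real l + 1)) * 2 ^ (l - 1) \<le> 1" .
    have "real (card (cycle_lists l)) \<le> real (2 * l * closed_trail_count l G)"
      by (intro of_nat_mono card_cycle_lists_le[OF G eg]) (use l in auto)
    also have "\<dots> = 2 * real l * real (closed_trail_count l G)" by simp
    also have "\<dots> \<le> 2 * real l * (C * exp (- (real l + 1)) * real d ^ (l - 1) * real n)"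
      using trails l by (intro mult_left_mono) auto
    also have "\<dots> = 2 * real l * C * real n * (exp (- (real l + 1)) * 2 ^ (l - 1)) * real h ^ (l - 1)"
      by (simp add: h power_mult_distrib)
    also have "\<dots> \<le> 2 * real l * C * real n * 1 * real h ^ (l - 1)"
      using C by (intro mult_right_mono mult_left_mono e) auto
    also have "\<dots> \<le> 2 * real L * C * real n * 1 * real h ^ (l - 1)"
      using C l by (intro mult_right_mono) auto
    finally show ?thesis using h_pos by (simp add: pos_divide_le_eq mult_ac)
  qed
  have "(\<Sum>l\<in>{3..L}. real (card (cycle_lists l)) / real h ^ (l - 1)) \<le> (\<Sum>l\<in>{3..L}. 2 * C * real L * real n)"
    by (rule sum_mono) (rule cyc)
  also have "\<dots> = real (card {3..L}) * (2 * C * real L * real n)" by simp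
  also have "\<dots> \<le> real L * (2 * C * real L * real n)"
    using C by (intro mult_right_mono) auto
  finally have S: "real L * (\<Sum>l\<in>{3..L}. real (card (cycle_lists l)) / real h ^ (l - 1))
      \<le> real L * (real L * (2 * C * real L * real n))" by (rule mult_left_mono) simp
  have "ln (real (EO G)) \<le> real n * pauling_estimate d + ln (real d) / real d *
      (real L * (\<Sum>l\<in>{3..L}. real (card (cycle_lists l)) / real h ^ (l - 1)) + real (card darts) / real (Suc L))"
    using ln_eulers_upper[of L] lnO unfolding EO n(1) \<beta>_def h[symmetric] by simp
  also have "\<dots> \<le> real n * pauling_estimate d + ln (real d) / real d *
      (real L * (real L * (2 * C * real L * real n)) + real (card darts) / real (Suc L))"
    using d by (intro add_left_mono mult_left_mono add_right_mono S) auto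
  also have "\<dots> = real n * (pauling_estimate d + ln (real d) * (2 * C * real L ^ 3 / real d + 1 / real (Suc L)))"
  proof -
    have cd: "real (card darts) = real n * real d" by (simp add: card_darts n(1) h)
    have "x / y * (a * (a * (2 * C * a * m)) + m * y / s) = m * (x * (2 * C * a ^ 3 / y + 1 / s))"
      if "y > 0" "s > 0" for x y a m s :: real
    proof -
      have "x / y * (m * y / s) = m * (x / s)" using that by simp
      then show ?thesis by (simp add: distrib_left power3_eq_cube mult_ac)
    qed
    then show ?thesis using d unfolding cd by (simp add: distrib_left)
  qed
  finally have "ln (real (EO G)) / real n
      \<le> pauling_estimate d + ln (real d) * (2 * C * real L ^ 3 / real d + 1 / real (Suc L))"
    using np by (simp add: pos_divide_le_eq mult.commute)
  then show "residual_entropy G - pauling_estimate d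
      \<le> ln (real d) * (2 * C * real L ^ 3 / real d + 1 / real (Suc L))"
    by (simp add: residual_entropy_def n(1))
qed

theorem theorem2p1:
  fixes G :: "nat \<Rightarrow> 'a ugraph"
    and d :: "nat \<Rightarrow> nat"
    and lmax :: "nat \<Rightarrow> real"
    and C :: real
  assumes "\<And>n. simple_graph (G n)"
    and "\<And>n. card (verts (G n)) = n"
    and "\<And>n. regular_graph (d n) (G n)"
    and "\<And>n. even (d n)"
    and "filterlim d at_top sequentially"
    and "filterlim (\<lambda>n. lmax n / ln (real (d n))) at_top sequentially"
    and "C > 0"
    and "\<And>n l. 3 \<le> l \<Longrightarrow> real l \<le> lmax n \<Longrightarrow>
           real (closed_trail_count l (G n))
             \<le> C * exp (- (real l + 1)) * real (d n) ^ (l - 1) * real n"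
  shows "(\<lambda>n. residual_entropy (G n) - pauling_estimate (d n)) \<in> o(\<lambda>_. 1)"
proof -
  define g where "g n = ln (real (d n))" for n
  \<comment> \<open>The first term bounds the effect of bad darts; the other two stem from the two
    candidates for the cut-off \<open>L\<close>.\<close>
  define B where "B n = 2 * C * (g n / real (d n) powr (1/2)) + (g n / lmax n + g n / real (d n) powr (1/6))" for n
  have ev: "eventually (\<lambda>n. 0 \<le> residual_entropy (G n) - pauling_estimate (d n) \<and>
      residual_entropy (G n) - pauling_estimate (d n) \<le> B n) sequentially"
  proof -
    have "eventually (\<lambda>n. d n \<ge> 2) sequentially"
      using assms(5) by (simp add: filterlim_at_top)
    moreover have "eventually (\<lambda>n. lmax n / g n \<ge> 1) sequentially"
      using assms(6) by (simp add: filterlim_at_top g_def)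
    moreover have "eventually (\<lambda>n. n > 0) sequentially" by (rule eventually_gt_at_top)
    ultimately show ?thesis
    proof eventually_elim
      case (elim n)
      define D where "D = real (d n)"
      have D: "D \<ge> 2" using elim by (simp add: D_def)
      have g: "g n > 0" using D by (simp add: g_def D_def)
      have lm: "lmax n > 0" using elim(2) g by (simp add: pos_le_divide_eq)
      \<comment> \<open>The exponent \<open>1/6\<close> makes \<open>L ^ 3 / D\<close> at most
        \<open>1 / D powr (1/2)\<close>, while \<open>ln D / D powr (1/6)\<close> still tends to
        0.\<close>
      define m where "m = min (lmax n) (D powr (1/6))"
      have m: "m > 0" using lm D by (simp add: m_def)
      define L where "L = nat \<lfloor>m\<rfloor>"
      \<comment> \<open>The first bound keeps the lengths within the range of the hypothesis, the
        second controls \<open>1 / real (Suc L)\<close>.\<close>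
      have Lm: "real L \<le> m" "m \<le> real (Suc L)" using m unfolding L_def by linarith+
      have "real (closed_trail_count l (G n)) \<le> C * exp (- (real l + 1)) * real (d n) ^ (l - 1) * real n"
        if "3 \<le> l" "l \<le> L" for l
        by (rule assms(8)) (use that Lm in \<open>auto simp: m_def\<close>)
      from residual_entropy_bounds[OF assms(1,3,4) _ assms(2) elim(3) assms(7) this]
      have 1: "0 \<le> residual_entropy (G n) - pauling_estimate (d n)"
        and 2: "residual_entropy (G n) - pauling_estimate (d n)
          \<le> g n * (2 * C * real L ^ 3 / D + 1 / real (Suc L))"
        using elim(1) by (simp_all add: g_def D_def)
      have "real L ^ 3 \<le> (D powr (1/6)) ^ 3"
        using Lm by (intro power_mono) (auto simp: m_def)
      also have "\<dots> = D powr (1/2)" using D by (simp add: powr_power)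
      finally have "real L ^ 3 / D \<le> D powr (1/2) / D" using D by (intro divide_right_mono) auto
      also have "\<dots> = 1 / D powr (1/2)"
        using D by (simp add: field_simps powr_add[symmetric])
      finally have 3: "real L ^ 3 / D \<le> 1 / D powr (1/2)" .
      have "1 / real (Suc L) \<le> 1 / m" using Lm m by (intro divide_left_mono) auto
      also have "\<dots> \<le> 1 / lmax n + 1 / D powr (1/6)"
        using lm D by (auto simp: m_def min_def)
      finally have 4: "1 / real (Suc L) \<le> 1 / lmax n + 1 / D powr (1/6)" .
      have "g n * (2 * C * (real L ^ 3 / D) + 1 / real (Suc L))
          \<le> g n * (2 * C * (1 / D powr (1/2)) + (1 / lmax n + 1 / D powr (1/6)))"
        using g assms(7) by (intro mult_left_mono add_mono 3 4) auto
      also have "\<dots> = B n" by (simp add: B_def D_def distrib_left)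
      finally show ?case using 1 2 by simp
    qed
  qed
  have 0: "((\<lambda>n. g n / real (d n) powr s) \<longlongrightarrow> 0) sequentially" if "s > 0" for s
    unfolding g_def using filterlim_compose[OF lim_ln_over_power[OF that] assms(5)] .
  \<comment> \<open>The growth of \<open>lmax\<close> relative to \<open>ln d\<close> is what makes
    the contribution of good darts vanish when \<open>lmax\<close> is the smaller cut-off.\<close>
  have "((\<lambda>n. inverse (lmax n / g n)) \<longlongrightarrow> 0) sequentially"
    using tendsto_inverse_0_at_top[OF assms(6)] by (simp add: g_def)
  then have "((\<lambda>n. g n / lmax n) \<longlongrightarrow> 0) sequentially" by simp
  then have "(B \<longlongrightarrow> 2 * C * 0 + (0 + 0)) sequentially"
    unfolding B_def by (intro tendsto_intros 0) auto
  then have B: "(B \<longlongrightarrow> 0) sequentially" by simp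
  have "((\<lambda>n. residual_entropy (G n) - pauling_estimate (d n)) \<longlongrightarrow> 0) sequentially"
    by (rule tendsto_sandwich[OF _ _ tendsto_const B]; rule eventually_mono[OF ev]; simp)
  then show ?thesis by (intro smalloI_tendsto) auto
qed

end
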